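(* Let $M^2$ be a proper biharmonic surface in the unit Euclidean sphere $\mathbb{S}^n$ with parallel mean curvature vector field. Then $M$ is minimal in $\mathbb{S}^{n-1}\big(\tfrac1{\sqrt2}\big)$, i.e. $M$ is a minimal surface of a hypersphere $\mathbb{S}^{n-1}\big(\tfrac1{\sqrt2}\big)\subset\mathbb{S}^n$ of radius $\tfrac1{\sqrt2}$.
   Context: Manifolds are connected and smooth. For a smooth map $\phi:(M,g)\to(N,h)$ between Riemannian manifolds, the tension field is $\tau(\phi)=\operatorname{trace}\nabla d\phi$ and the bitension field is $\tau_2(\phi)=-\Delta\tau(\phi)-\operatorname{trace}R^N(d\phi,\tau(\phi))d\phi$, where $\Delta=-\operatorname{trace}\nabla^2$ is the rough Laplacian on sections of $\phi^{-1}TN$ and $R^N(X,Y)=[\nabla_X,\nabla_Y]-\nabla_{[X,Y]}$. The map $\phi$ is harmonic if $\tau(\phi)=0$, biharmonic if $\tau_2(\phi)=0$, and proper biharmonic if it is biharmonic and not harmonic. A submanifold $M$ of $N$ (with induced metric) is called biharmonic (resp. proper biharmonic) if its inclusion map is biharmonic (resp. proper biharmonic); the inclusion is harmonic exactly when $M$ is minimal. The mean curvature vector field of an $m$-dimensional submanifold is $H=\frac1m\operatorname{trace}B$, with $B$ the second fundamental form; it is parallel if $\nabla^\perp H=0$, where $\nabla^\perp$ is the normal connection. A hypersphere $\mathbb{S}^{n-1}(r)\subset\mathbb{S}^{n}$ of radius $r$ is an intersection of $\mathbb{S}^{n}\subset\mathbb{R}^{n+1}$ with an affine hyperplane that is a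 Euclidean sphere of radius $r$. *)

theory Defs
  imports "HOL-Analysis.Analysis"
begin

section \<open>Smooth manifolds\<close>

text \<open>\<^term>\<open>S\<close> is meant to be open in the following definition.\<close>

primrec C_k_on :: "nat \<Rightarrow> ('a::real_normed_vector \<Rightarrow> 'b::real_normed_vector) \<Rightarrow> 'a set \<Rightarrow> bool" where
  "C_k_on 0 f S \<longleftrightarrow> continuous_on S f"
| "C_k_on (Suc k) f S \<longleftrightarrow>
     (\<forall>x\<in>S. f differentiable (at x)) \<and> (\<forall>v. C_k_on k (\<lambda>x. frechet_derivative f (at x) v) S)"

definition smooth_on :: "('a::real_normed_vector \<Rightarrow> 'b::real_normed_vector) \<Rightarrow> 'a set \<Rightarrow> bool" where
  "smooth_on f S \<longleftrightarrow> (\<forall>k. C_k_on k f S)"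

text \<open>A chart is a pair of its domain \<^term>\<open>D\<close> and a coordinate map \<^term>\<open>c\<close> (only the values
  of \<^term>\<open>c\<close> on \<^term>\<open>D\<close> matter); its inverse is \<^term>\<open>inv_into D c\<close>. The dimension of the manifold is
  \<^term>\<open>CARD('m)\<close>. Manifolds are connected by convention.\<close>

type_synonym ('p, 'm) chart = "'p set \<times> ('p \<Rightarrow> real ^ 'm)"

definition smooth_manifold :: "'p topology \<Rightarrow> ('p, 'm::finite) chart set \<Rightarrow> bool" where
  "smooth_manifold X \<A> \<longleftrightarrow>
     Hausdorff_space X \<and> second_countable X \<and> connected_space X \<and>
     (\<Union>(D, c)\<in>\<A>. D) = topspace X \<and>
     (\<forall>(D, c)\<in>\<A>. openin X D \<and> open (c ` D) \<and>
        homeomorphic_map (subtopology X D) (subtopology euclidean (c ` D)) c) \<and>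
     (\<forall>(D, c)\<in>\<A>. \<forall>(D', c')\<in>\<A>. smooth_on (c' \<circ> inv_into D c) (c ` (D \<inter> D')))"


section \<open>The target: submanifolds of a Euclidean space\<close>

text \<open>The Riemannian manifold \<^term>\<open>N\<close> that is mapped into is an embedded submanifold of a Euclidean
  space \<^typ>\<open>'e\<close>, with the induced metric. Its tangent vectors at \<^term>\<open>p\<close> are the velocities of the
  curves in \<^term>\<open>N\<close> through \<^term>\<open>p\<close>; differentiability at the time 0 suffices, because \<^term>\<open>N\<close> is
  embedded.\<close>

definition curve_at :: "'e::real_normed_vector set \<Rightarrow> 'e \<Rightarrow> 'e \<Rightarrow> (real \<Rightarrow> 'e) \<Rightarrow> bool" where
  "curve_at N p v \<gamma> \<longleftrightarrow> range \<gamma> \<subseteq> N \<and> \<gamma> 0 = p \<and> (\<gamma> has_vector_derivative v) (at 0)"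

definition tangent_space :: "'e::real_normed_vector set \<Rightarrow> 'e \<Rightarrow> 'e set" where
  "tangent_space N p = {v. \<exists>\<gamma>. curve_at N p v \<gamma>}"

definition orth_proj :: "'e::real_inner set \<Rightarrow> 'e \<Rightarrow> 'e" where
  "orth_proj W v = (THE w. w \<in> W \<and> (\<forall>s\<in>W. (v - w) \<bullet> s = 0))"

definition tan_proj :: "'e::real_inner set \<Rightarrow> 'e \<Rightarrow> 'e \<Rightarrow> 'e" where
  "tan_proj N p = orth_proj (tangent_space N p)"

text \<open>The derivative at \<^term>\<open>p\<close> in the tangent direction \<^term>\<open>v\<close> of a function that needs to be
  given only on \<^term>\<open>N\<close>.\<close>

definition dir_deriv :: "'e::real_normed_vector set \<Rightarrow> ('e \<Rightarrow> 'e) \<Rightarrow> 'e \<Rightarrow> 'e \<Rightarrow> 'e" where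
  "dir_deriv N Y p v =
     (THE w. \<forall>\<gamma>. curve_at N p v \<gamma> \<longrightarrow> ((Y \<circ> \<gamma>) has_vector_derivative w) (at 0))"

text \<open>Vector fields on \<^term>\<open>N\<close> are represented as \<^typ>\<open>'e\<close>-valued functions. The Levi-Civita
  connection of the induced metric is the tangential part of the flat derivative of
  \<^typ>\<open>'e\<close>, and the Lie bracket of two tangent fields is the commutator of directional derivatives.\<close>

definition conn :: "'e::real_inner set \<Rightarrow> ('e \<Rightarrow> 'e) \<Rightarrow> ('e \<Rightarrow> 'e) \<Rightarrow> 'e \<Rightarrow> 'e" where
  "conn N X Y p = tan_proj N p (dir_deriv N Y p (X p))"

definition lie_bracket :: "'e::real_inner set \<Rightarrow> ('e \<Rightarrow> 'e) \<Rightarrow> ('e \<Rightarrow> 'e) \<Rightarrow> 'e \<Rightarrow> 'e" where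
  "lie_bracket N X Y p = dir_deriv N Y p (X p) - dir_deriv N X p (Y p)"

definition curv_field ::
  "'e::real_inner set \<Rightarrow> ('e \<Rightarrow> 'e) \<Rightarrow> ('e \<Rightarrow> 'e) \<Rightarrow> ('e \<Rightarrow> 'e) \<Rightarrow> 'e \<Rightarrow> 'e" where
  "curv_field N X Y Z p =
     conn N X (conn N Y Z) p - conn N Y (conn N X Z) p - conn N (lie_bracket N X Y) Z p"

text \<open>The curvature is tensorial, so its value at tangent vectors of \<^term>\<open>N\<close> at \<^term>\<open>p\<close> can be computed
  with any tangent fields extending them. Here a tangent vector \<^term>\<open>x\<close> is extended by the
  field that at every \<^term>\<open>q\<close> in \<^term>\<open>N\<close> is the tangential part of \<^term>\<open>x\<close>.\<close>

definition curvature :: "'e::real_inner set \<Rightarrow> 'e \<Rightarrow> 'e \<Rightarrow> 'e \<Rightarrow> 'e \<Rightarrow> 'e" where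
  "curvature N p x y z =
     curv_field N (\<lambda>q. tan_proj N q x) (\<lambda>q. tan_proj N q y) (\<lambda>q. tan_proj N q z) p"


section \<open>Maps in a chart of the source: tension and bitension field\<close>

text \<open>Below, \<^term>\<open>f :: real ^ 'm \<Rightarrow> 'e\<close> is the expression of a map into \<^term>\<open>N\<close> in a chart of the
  source manifold, \<^term>\<open>G u\<close> is the matrix of the metric of the source in this chart, and sections of the
  pull-back of the tangent bundle of \<^term>\<open>N\<close> are functions \<^term>\<open>V :: real ^ 'm \<Rightarrow> 'e\<close> such that
  \<^term>\<open>V u\<close> is tangent to \<^term>\<open>N\<close> at \<^term>\<open>f u\<close>.\<close>

definition partial_deriv ::
  "'m \<Rightarrow> (real ^ 'm::finite \<Rightarrow> 'b::real_normed_vector) \<Rightarrow> real ^ 'm \<Rightarrow> 'b" where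
  "partial_deriv i V u = frechet_derivative V (at u) (axis i 1)"

definition christoffel ::
  "(real ^ 'm::finite \<Rightarrow> real ^ 'm ^ 'm) \<Rightarrow> 'm \<Rightarrow> 'm \<Rightarrow> 'm \<Rightarrow> real ^ 'm \<Rightarrow> real" where
  "christoffel G k i j u =
     (\<Sum>l\<in>UNIV. matrix_inv (G u) $ k $ l *
        (partial_deriv i (\<lambda>v. G v $ j $ l) u + partial_deriv j (\<lambda>v. G v $ i $ l) u
           - partial_deriv l (\<lambda>v. G v $ i $ j) u)) / 2"

text \<open>The pull-back connection on sections along \<^term>\<open>f\<close>.\<close>

definition cov_deriv ::
  "'e::real_inner set \<Rightarrow> (real ^ 'm::finite \<Rightarrow> 'e) \<Rightarrow> 'm \<Rightarrow> (real ^ 'm \<Rightarrow> 'e) \<Rightarrow> real ^ 'm \<Rightarrow> 'e" where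
  "cov_deriv N f i V u = tan_proj N (f u) (partial_deriv i V u)"

text \<open>The following two facts show that the connection defined here is torsion-free and that its
  pull-back is metric, which characterizes the Levi-Civita connection.\<close>

lemma orth_proj_unique:
  fixes W :: "'e::real_inner set"
  assumes "subspace W" "w \<in> W" "\<And>s. s \<in> W \<Longrightarrow> (v - w) \<bullet> s = 0"
  shows "orth_proj W v = w"
  unfolding orth_proj_def
proof (rule the_equality)
  show "w \<in> W \<and> (\<forall>s\<in>W. (v - w) \<bullet> s = 0)"
    using assms by blast
next
  fix w' assume w': "w' \<in> W \<and> (\<forall>s\<in>W. (v - w') \<bullet> s = 0)"
  have "w - w' \<in> W"
    using assms w' by (simp add: subspace_diff)
  then have "(v - w') \<bullet> (w - w') = 0" "(v - w) \<bullet> (w - w') = 0"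
    using assms w' by blast+
  then have "(w - w') \<bullet> (w - w') = 0"
    by (simp add: inner_diff_left)
  then show "w' = w"
    by simp
qed

lemma orth_proj:
  fixes W :: "'e::euclidean_space set"
  assumes "subspace W"
  shows "orth_proj W v \<in> W" and "s \<in> W \<Longrightarrow> (v - orth_proj W v) \<bullet> s = 0"
proof -
  obtain y z where yz: "y \<in> span W" "\<And>w. w \<in> span W \<Longrightarrow> orthogonal z w" "v = y + z"
    using orthogonal_subspace_decomp_exists by blast
  have span: "span W = W"
    using assms by (simp add: span_eq_iff)
  have "orth_proj W v = y"
    by (rule orth_proj_unique) (use assms yz span in \<open>auto simp: orthogonal_def\<close>)
  then show "orth_proj W v \<in> W" "s \<in> W \<Longrightarrow> (v - orth_proj W v) \<bullet> s = 0"
    using yz span by (auto simp: orthogonal_def)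
qed

lemma conn_torsion_free:
  fixes N :: "'e::euclidean_space set"
  assumes "subspace (tangent_space N p)" "lie_bracket N X Y p \<in> tangent_space N p"
  shows "conn N X Y p - conn N Y X p = lie_bracket N X Y p"
proof -
  define T where "T = tangent_space N p"
  define a where "a = dir_deriv N Y p (X p)"
  define b where "b = dir_deriv N X p (Y p)"
  have T: "subspace T" and ab: "a - b \<in> T"
    using assms by (simp_all add: T_def a_def b_def lie_bracket_def)
  have "orth_proj T a = orth_proj T b + (a - b)"
  proof (rule orth_proj_unique[OF T])
    show "orth_proj T b + (a - b) \<in> T"
      using T ab orth_proj(1)[OF T] subspace_add by blast
    show "(a - (orth_proj T b + (a - b))) \<bullet> s = 0" if "s \<in> T" for s
      using orth_proj(2)[OF T that, of b] by (simp add: algebra_simps)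
  qed
  then show ?thesis
    by (simp add: conn_def tan_proj_def lie_bracket_def T_def a_def b_def)
qed

lemma cov_deriv_metric:
  fixes N :: "'e::euclidean_space set"
  assumes "subspace (tangent_space N (f u))"
    and "V u \<in> tangent_space N (f u)" "W u \<in> tangent_space N (f u)"
    and "V differentiable (at u)" "W differentiable (at u)"
  shows "partial_deriv i (\<lambda>u. V u \<bullet> W u) u = cov_deriv N f i V u \<bullet> W u + V u \<bullet> cov_deriv N f i W u"
proof -
  have "((\<lambda>u. V u \<bullet> W u) has_derivative
      (\<lambda>h. V u \<bullet> frechet_derivative W (at u) h + frechet_derivative V (at u) h \<bullet> W u)) (at u)"
    using assms(4,5) by (intro has_derivative_inner) (simp_all add: frechet_derivative_works[symmetric])
  then have "partial_deriv i (\<lambda>u. V u \<bullet> W u) u = V u \<bullet> partial_deriv i W u + partial_deriv i V u \<bullet> W u"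
    unfolding partial_deriv_def by (simp add: frechet_derivative_at[symmetric])
  moreover have "(partial_deriv i V u - cov_deriv N f i V u) \<bullet> W u = 0"
    "(partial_deriv i W u - cov_deriv N f i W u) \<bullet> V u = 0"
    using orth_proj(2)[OF assms(1)] assms(2,3) by (auto simp: cov_deriv_def tan_proj_def)
  ultimately show ?thesis
    by (simp add: inner_diff_left inner_diff_right inner_commute)
qed

text \<open>\<open>(\<nabla>df)(\<partial>\<^sub>i, \<partial>\<^sub>j) = \<nabla>\<^sub>i (df \<partial>\<^sub>j) - df (\<nabla>\<^sub>i \<partial>\<^sub>j)\<close>\<close>

definition hessian_map ::
  "'e::real_inner set \<Rightarrow> (real ^ 'm::finite \<Rightarrow> real ^ 'm ^ 'm) \<Rightarrow> (real ^ 'm \<Rightarrow> 'e)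
     \<Rightarrow> 'm \<Rightarrow> 'm \<Rightarrow> real ^ 'm \<Rightarrow> 'e" where
  "hessian_map N G f i j u =
     cov_deriv N f i (partial_deriv j f) u
       - (\<Sum>k\<in>UNIV. christoffel G k i j u *\<^sub>R partial_deriv k f u)"

definition metric_trace ::
  "real ^ 'm ^ 'm::finite \<Rightarrow> ('m \<Rightarrow> 'm \<Rightarrow> 'e::real_vector) \<Rightarrow> 'e" where
  "metric_trace g T = (\<Sum>i\<in>UNIV. \<Sum>j\<in>UNIV. matrix_inv g $ i $ j *\<^sub>R T i j)"

definition tension ::
  "'e::real_inner set \<Rightarrow> (real ^ 'm::finite \<Rightarrow> real ^ 'm ^ 'm) \<Rightarrow> (real ^ 'm \<Rightarrow> 'e) \<Rightarrow> real ^ 'm \<Rightarrow> 'e" where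
  "tension N G f u = metric_trace (G u) (\<lambda>i j. hessian_map N G f i j u)"

text \<open>The rough Laplacian with the sign convention \<open>\<Delta> = - trace \<nabla>\<^sup>2\<close>, where
  \<open>\<nabla>\<^sup>2\<^sub>i\<^sub>j V = \<nabla>\<^sub>i \<nabla>\<^sub>j V - (\<nabla> V)(\<nabla>\<^sub>i \<partial>\<^sub>j)\<close>.\<close>

definition rough_laplacian ::
  "'e::real_inner set \<Rightarrow> (real ^ 'm::finite \<Rightarrow> real ^ 'm ^ 'm) \<Rightarrow> (real ^ 'm \<Rightarrow> 'e)
     \<Rightarrow> (real ^ 'm \<Rightarrow> 'e) \<Rightarrow> real ^ 'm \<Rightarrow> 'e" where
  "rough_laplacian N G f V u =
     - metric_trace (G u) (\<lambda>i j. cov_deriv N f i (cov_deriv N f j V) u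
         - (\<Sum>k\<in>UNIV. christoffel G k i j u *\<^sub>R cov_deriv N f k V u))"

definition bitension ::
  "'e::real_inner set \<Rightarrow> (real ^ 'm::finite \<Rightarrow> real ^ 'm ^ 'm) \<Rightarrow> (real ^ 'm \<Rightarrow> 'e) \<Rightarrow> real ^ 'm \<Rightarrow> 'e" where
  "bitension N G f u =
     - rough_laplacian N G f (tension N G f) u
     - metric_trace (G u) (\<lambda>i j. curvature N (f u) (partial_deriv i f u) (tension N G f u)
                                   (partial_deriv j f u))"


section \<open>Submanifolds in a chart: second fundamental form and mean curvature\<close>

definition induced_metric :: "(real ^ 'm::finite \<Rightarrow> 'e::real_inner) \<Rightarrow> real ^ 'm \<Rightarrow> real ^ 'm ^ 'm" where
  "induced_metric f u = (\<chi> i j. partial_deriv i f u \<bullet> partial_deriv j f u)"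

text \<open>The component normal to the submanifold parametrized by \<^term>\<open>f\<close> of a tangent vector
  \<^term>\<open>w\<close> of the ambient manifold at \<^term>\<open>f u\<close>.\<close>

definition normal_part ::
  "(real ^ 'm::finite \<Rightarrow> 'e::real_inner) \<Rightarrow> real ^ 'm \<Rightarrow> 'e \<Rightarrow> 'e" where
  "normal_part f u w = w - orth_proj (span (range (\<lambda>k. partial_deriv k f u))) w"

definition second_fundamental_form ::
  "'e::real_inner set \<Rightarrow> (real ^ 'm::finite \<Rightarrow> 'e) \<Rightarrow> 'm \<Rightarrow> 'm \<Rightarrow> real ^ 'm \<Rightarrow> 'e" where
  "second_fundamental_form N f i j u = normal_part f u (cov_deriv N f i (partial_deriv j f) u)"

definition mean_curvature ::
  "'e::real_inner set \<Rightarrow> (real ^ 'm::finite \<Rightarrow> 'e) \<Rightarrow> real ^ 'm \<Rightarrow> 'e" where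
  "mean_curvature N f u =
     (1 / real CARD('m)) *\<^sub>R
       metric_trace (induced_metric f u) (\<lambda>i j. second_fundamental_form N f i j u)"

definition normal_conn ::
  "'e::real_inner set \<Rightarrow> (real ^ 'm::finite \<Rightarrow> 'e) \<Rightarrow> 'm \<Rightarrow> (real ^ 'm \<Rightarrow> 'e) \<Rightarrow> real ^ 'm \<Rightarrow> 'e" where
  "normal_conn N f i V u = normal_part f u (cov_deriv N f i V u)"


section \<open>Global notions\<close>

text \<open>Submanifolds are immersed: \<^term>\<open>\<phi>\<close> plays the role of the inclusion, which is the case where
  \<^typ>\<open>'p\<close> is \<^typ>\<open>'e\<close> and \<^term>\<open>\<phi>\<close> is the identity on \<^term>\<open>topspace X\<close>. All the
  objects above are compatible with changes of charts, so the conditions are stated in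
  every chart of the atlas.\<close>

definition submanifold ::
  "'p topology \<Rightarrow> ('p, 'm::finite) chart set \<Rightarrow> ('p \<Rightarrow> 'e::real_inner) \<Rightarrow> 'e set \<Rightarrow> bool" where
  "submanifold X \<A> \<phi> N \<longleftrightarrow>
     smooth_manifold X \<A> \<and> \<phi> ` topspace X \<subseteq> N \<and>
     (\<forall>(D, c)\<in>\<A>. smooth_on (\<phi> \<circ> inv_into D c) (c ` D) \<and>
        (\<forall>u\<in>c ` D. inj (frechet_derivative (\<phi> \<circ> inv_into D c) (at u))))"

text \<open>Harmonicity and biharmonicity of the inclusion, for the induced metric on the source.\<close>

definition harmonic_submanifold ::
  "('p, 'm::finite) chart set \<Rightarrow> ('p \<Rightarrow> 'e::real_inner) \<Rightarrow> 'e set \<Rightarrow> bool" where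
  "harmonic_submanifold \<A> \<phi> N \<longleftrightarrow>
     (\<forall>(D, c)\<in>\<A>. let f = \<phi> \<circ> inv_into D c in \<forall>u\<in>c ` D. tension N (induced_metric f) f u = 0)"

definition biharmonic_submanifold ::
  "('p, 'm::finite) chart set \<Rightarrow> ('p \<Rightarrow> 'e::real_inner) \<Rightarrow> 'e set \<Rightarrow> bool" where
  "biharmonic_submanifold \<A> \<phi> N \<longleftrightarrow>
     (\<forall>(D, c)\<in>\<A>. let f = \<phi> \<circ> inv_into D c in \<forall>u\<in>c ` D. bitension N (induced_metric f) f u = 0)"

definition proper_biharmonic_submanifold ::
  "('p, 'm::finite) chart set \<Rightarrow> ('p \<Rightarrow> 'e::real_inner) \<Rightarrow> 'e set \<Rightarrow> bool" where
  "proper_biharmonic_submanifold \<A> \<phi> N \<longleftrightarrow>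
     biharmonic_submanifold \<A> \<phi> N \<and> \<not> harmonic_submanifold \<A> \<phi> N"

definition parallel_mean_curvature ::
  "('p, 'm::finite) chart set \<Rightarrow> ('p \<Rightarrow> 'e::real_inner) \<Rightarrow> 'e set \<Rightarrow> bool" where
  "parallel_mean_curvature \<A> \<phi> N \<longleftrightarrow>
     (\<forall>(D, c)\<in>\<A>. let f = \<phi> \<circ> inv_into D c in
        \<forall>u\<in>c ` D. \<forall>i. normal_conn N f i (mean_curvature N f) u = 0)"

definition minimal_submanifold ::
  "'p topology \<Rightarrow> ('p, 'm::finite) chart set \<Rightarrow> ('p \<Rightarrow> 'e::real_inner) \<Rightarrow> 'e set \<Rightarrow> bool" where
  "minimal_submanifold X \<A> \<phi> N \<longleftrightarrow> submanifold X \<A> \<phi> N \<and>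
     (\<forall>(D, c)\<in>\<A>. \<forall>u\<in>c ` D. mean_curvature N (\<phi> \<circ> inv_into D c) u = 0)"

text \<open>\<^term>\<open>S\<close> is a hypersphere of radius \<^term>\<open>r\<close> of the unit sphere of \<^typ>\<open>'e\<close>.\<close>

definition hypersphere :: "real \<Rightarrow> 'e::euclidean_space set \<Rightarrow> bool" where
  "hypersphere r S \<longleftrightarrow> r > 0 \<and>
     (\<exists>a b p. a \<noteq> 0 \<and> a \<bullet> p = b \<and>
        S = sphere 0 1 \<inter> {x. a \<bullet> x = b} \<and> S = sphere p r \<inter> {x. a \<bullet> x = b})"

end

theory Submission
  imports Defs
begin

text \<open>Let \<open>f\<close> be the expression of the immersion in a chart, \<open>H\<close> its mean curvature vector and
  \<open>k = |H|\<^sup>2\<close>. The differential of \<open>H\<close> is tangent to the surface because \<open>H\<close> is parallel in the normal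
  bundle; so \<open>dH = - df \<circ> A\<close> with a self-adjoint operator \<open>A\<close>, the shape operator in the direction of
  \<open>H\<close>, and \<open>k\<close> is locally constant. The trace of \<open>A\<close> is \<open>2k\<close>. Pairing the biharmonic equation with \<open>H\<close>
  shows that \<open>trace A\<^sup>2 = 2k\<close> as well. Hence \<open>A\<close> has constant eigenvalues, \<open>k\<close> plus or minus the square
  root of \<open>k (1 - k)\<close>, and \<open>k \<le> 1\<close> (\<open>third_form_relation\<close>, \<open>norm_H_le_1\<close>).

  The case \<open>0 < k < 1\<close> is impossible (\<open>no_distinct_principal_curvatures\<close>). Let \<open>\<lambda> \<noteq> \<mu>\<close> be the two
  eigenvalues. The differentials of \<open>P = H + \<lambda> f\<close> and \<open>Q = H + \<mu> f\<close> have rank one and orthogonal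
  images, and \<open>f\<close> is a multiple of \<open>P - Q\<close>. Such a surface is, up to a constant factor, the sum of two
  curves with orthogonal velocities, so it is flat. On the other hand, the normal part of the biharmonic
  equation determines the second fundamental form and gives it the Gauss curvature \<open>2k > 0\<close>. Flatness
  is derived from the second derivatives of the relation that the images of \<open>dP\<close> and \<open>dQ\<close> are
  orthogonal; coordinates adapted to the two curves are not introduced.

  Therefore \<open>k\<close> is 0 or 1 at every point. The mean curvature vector does not depend on the chart
  (\<open>mean_curvature_change_of_chart\<close>), the manifold is connected, and the surface is not harmonic; so
  \<open>k = 1\<close> everywhere. Then \<open>A\<close> is the identity (\<open>umbilic_if_norm_1\<close>), \<open>dH = - df\<close>, and \<open>q = f + H\<close> is
  constant. As \<open>|q|\<^sup>2 = 2\<close> and \<open>q \<bullet> f = 1\<close>, the surface lies in the hypersphere of radius \<open>1 / sqrt 2\<close>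
  that is cut out by the hyperplane \<open>q \<bullet> x = 1\<close>. The unit normal of this hypersphere in the unit sphere
  is \<open>H\<close>, up to sign, so the mean curvature vector of the surface has no component tangent to the
  hypersphere (\<open>minimal_in_hypersphere\<close>).

  Traces with respect to the induced metric are evaluated in a basis \<open>X\<close>, \<open>Y\<close> of the parameter plane
  that the differential of \<open>f\<close> maps to an orthonormal basis of the tangent plane (\<open>metric_trace_frame\<close>).
  The basis is chosen separately at each point, with constant coefficients, so no derivatives of a
  moving frame occur.\<close>

section \<open>Directional derivatives and smooth functions\<close>

definition vderiv :: "'a::real_normed_vector \<Rightarrow> ('a \<Rightarrow> 'b::real_normed_vector) \<Rightarrow> 'a \<Rightarrow> 'b" where
  "vderiv v f u = frechet_derivative f (at u) v"

lemma partial_deriv_eq_vderiv: "partial_deriv i f = vderiv (axis i 1) f"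
  by (simp add: partial_deriv_def vderiv_def fun_eq_iff)

lemma vderivI: "(f has_derivative f') (at u) \<Longrightarrow> vderiv v f u = f' v"
  by (simp add: vderiv_def frechet_derivative_at[symmetric])

lemma has_derivative_vderiv:
  "f differentiable (at u) \<Longrightarrow> (f has_derivative (\<lambda>v. vderiv v f u)) (at u)"
  by (simp add: vderiv_def frechet_derivative_works)

text \<open>This includes points where the functions are not differentiable: there the derivative is chosen
  by a predicate that is unsatisfiable, and it is the same predicate for both functions.\<close>

lemma vderiv_cong_open:
  assumes "open S" "u \<in> S" "\<And>x. x \<in> S \<Longrightarrow> f x = g x"
  shows "vderiv v f u = vderiv v g u"
proof (cases "f differentiable (at u)")
  case True
  then show ?thesis unfolding vderiv_def
    using frechet_derivative_transform_within_open[OF True assms(1,2)] assms(3) by metis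
next
  case False
  have "(f has_derivative f') (at u) \<longleftrightarrow> (g has_derivative f') (at u)" for f'
    using has_derivative_transform_within_open[OF _ assms(1,2)] assms(3) by metis
  then show ?thesis by (simp add: vderiv_def frechet_derivative_def)
qed

lemma differentiable_cong_open:
  assumes "open S" "u \<in> S" "\<And>x. x \<in> S \<Longrightarrow> f x = g x"
  shows "f differentiable (at u) \<longleftrightarrow> g differentiable (at u)"
  unfolding differentiable_def
  using has_derivative_transform_within_open[OF _ assms(1,2)] assms(3) by metis

lemma linear_vderiv: "f differentiable (at u) \<Longrightarrow> linear (\<lambda>v. vderiv v f u)"
  unfolding vderiv_def by (simp add: linear_frechet_derivative)

lemma vderiv_const [simp]: "vderiv v (\<lambda>x. c) u = 0"
  by (simp add: vderiv_def)

lemma vderiv_add: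
  "f differentiable (at u) \<Longrightarrow> g differentiable (at u) \<Longrightarrow>
    vderiv v (\<lambda>x. f x + g x) u = vderiv v f u + vderiv v g u"
  by (rule vderivI[OF has_derivative_add[OF has_derivative_vderiv has_derivative_vderiv]])

lemma vderiv_scaleR_const:
  "f differentiable (at u) \<Longrightarrow> vderiv v (\<lambda>x. c *\<^sub>R f x) u = c *\<^sub>R vderiv v f u"
  by (rule vderivI[OF has_derivative_scaleR_right[OF has_derivative_vderiv]])

lemma vderiv_bilinear:
  assumes "bounded_bilinear p" "f differentiable (at u)" "g differentiable (at u)"
  shows "vderiv v (\<lambda>x. p (f x) (g x)) u = p (f u) (vderiv v g u) + p (vderiv v f u) (g u)"
  by (rule vderivI[OF bounded_bilinear.FDERIV[OF assms(1) has_derivative_vderiv has_derivative_vderiv], OF assms(2,3)])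

lemma vderiv_inner:
  fixes f g :: "'a::real_normed_vector \<Rightarrow> 'b::real_inner"
  assumes "f differentiable (at u)" "g differentiable (at u)"
  shows "vderiv v (\<lambda>x. f x \<bullet> g x) u = f u \<bullet> vderiv v g u + vderiv v f u \<bullet> g u"
  by (rule vderiv_bilinear[OF bounded_bilinear_inner assms])

lemma C_k_on_Suc:
  "C_k_on (Suc k) f S \<longleftrightarrow> (\<forall>x\<in>S. f differentiable (at x)) \<and> (\<forall>v. C_k_on k (vderiv v f) S)"
  by (simp add: vderiv_def[abs_def])

lemma C_k_on_vderiv: "C_k_on (Suc k) f S \<Longrightarrow> C_k_on k (vderiv v f) S"
  by (simp only: C_k_on_Suc)

text \<open>One derivative less: the product and reciprocal rules below express a derivative of order
  \<open>k + 1\<close> through the given functions themselves, which must then be known to be of class \<open>C\<^sup>k\<close>.\<close>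

lemma C_k_on_SucD: "C_k_on (Suc k) f S \<Longrightarrow> C_k_on k f S"
proof (induction k arbitrary: f)
  case 0
  then have "f differentiable_on S"
    unfolding C_k_on_Suc by (blast intro: differentiable_at_imp_differentiable_on)
  then show ?case
    unfolding C_k_on.simps(1) by (rule differentiable_imp_continuous_on)
next
  case (Suc k)
  then show ?case by (metis C_k_on_Suc)
qed

lemma C_k_on_cong:
  assumes "open S" "\<And>x. x \<in> S \<Longrightarrow> f x = g x"
  shows "C_k_on k f S \<longleftrightarrow> C_k_on k g S"
  using assms(2)
proof (induction k arbitrary: f g)
  case 0
  then show ?case by (simp cong: continuous_on_cong)
next
  case (Suc k)
  have "C_k_on k (vderiv v f) S \<longleftrightarrow> C_k_on k (vderiv v g) S" for v
    by (rule Suc.IH) (use vderiv_cong_open[OF assms(1)] Suc.prems in blast)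
  moreover have "(\<forall>x\<in>S. f differentiable (at x)) \<longleftrightarrow> (\<forall>x\<in>S. g differentiable (at x))"
    using differentiable_cong_open[OF assms(1)] Suc.prems by blast
  ultimately show ?case unfolding C_k_on_Suc by blast
qed

lemma C_k_on_const: "C_k_on k (\<lambda>x. c) S"
  by (induction k arbitrary: c) (simp_all)

lemma C_k_on_add:
  assumes "open S" "C_k_on k f S" "C_k_on k g S"
  shows "C_k_on k (\<lambda>x. f x + g x) S"
  using assms(2,3)
proof (induction k arbitrary: f g)
  case 0
  then show ?case by (simp add: continuous_on_add)
next
  case (Suc k)
  have "C_k_on k (vderiv v (\<lambda>x. f x + g x)) S" for v
  proof (subst C_k_on_cong[OF assms(1), of _ "\<lambda>x. vderiv v f x + vderiv v g x"])
    show "C_k_on k (\<lambda>x. vderiv v f x + vderiv v g x) S"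
      by (intro Suc.IH C_k_on_vderiv Suc.prems)
  next
    fix x assume "x \<in> S"
    then have "f differentiable (at x)" "g differentiable (at x)" using Suc.prems by auto
    then show "vderiv v (\<lambda>x. f x + g x) x = vderiv v f x + vderiv v g x" by (rule vderiv_add)
  qed
  then show ?case using Suc.prems by (auto simp: C_k_on_Suc simp del: C_k_on.simps(2))
qed

lemma C_k_on_bilinear:
  assumes "bounded_bilinear p" "open S" "C_k_on k f S" "C_k_on k g S"
  shows "C_k_on k (\<lambda>x. p (f x) (g x)) S"
  using assms(3,4)
proof (induction k arbitrary: f g)
  case 0
  then show ?case by (simp add: bounded_bilinear.continuous_on[OF assms(1)])
next
  case (Suc k)
  have diff: "\<And>x. x \<in> S \<Longrightarrow> f differentiable (at x)" "\<And>x. x \<in> S \<Longrightarrow> g differentiable (at x)"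
    using Suc.prems by auto
  have "C_k_on k (vderiv v (\<lambda>x. p (f x) (g x))) S" for v
  proof (subst C_k_on_cong[OF assms(2), of _ "\<lambda>x. p (f x) (vderiv v g x) + p (vderiv v f x) (g x)"])
    show "C_k_on k (\<lambda>x. p (f x) (vderiv v g x) + p (vderiv v f x) (g x)) S"
      by (intro C_k_on_add[OF assms(2)] Suc.IH C_k_on_vderiv Suc.prems Suc.prems[THEN C_k_on_SucD])
  qed (auto simp: vderiv_bilinear[OF assms(1)] diff)
  moreover have "(\<lambda>x. p (f x) (g x)) differentiable (at x)" if "x \<in> S" for x
    using bounded_bilinear.FDERIV[OF assms(1) has_derivative_vderiv has_derivative_vderiv] diff that
    unfolding differentiable_def by blast
  ultimately show ?case by (simp add: C_k_on_Suc del: C_k_on.simps(2))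
qed

lemma C_k_on_inverse:
  fixes f :: "'a::real_normed_vector \<Rightarrow> real"
  assumes "open S" "C_k_on k f S" "\<And>x. x \<in> S \<Longrightarrow> f x \<noteq> 0"
  shows "C_k_on k (\<lambda>x. inverse (f x)) S"
  using assms(2)
proof (induction k)
  case 0
  then show ?case using assms(3) by (simp add: continuous_on_inverse)
next
  case (Suc k)
  have inv: "((\<lambda>x. inverse (f x)) has_derivative
      (\<lambda>h. - (inverse (f x) * vderiv h f x * inverse (f x)))) (at x)" if "x \<in> S" for x
    using Suc.prems assms(3) that by (intro Deriv.has_derivative_inverse has_derivative_vderiv) auto
  have "C_k_on k (vderiv v (\<lambda>x. inverse (f x))) S" for v
  proof (subst C_k_on_cong[OF assms(1), of _ "\<lambda>x. (- 1) * ((inverse (f x) * vderiv v f x) * inverse (f x))"])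
    show "C_k_on k (\<lambda>x. (- 1) * ((inverse (f x) * vderiv v f x) * inverse (f x))) S"
      by (intro C_k_on_bilinear[OF bounded_bilinear_mult assms(1)] C_k_on_const
          C_k_on_vderiv Suc.IH Suc.prems Suc.prems[THEN C_k_on_SucD])
  qed (use vderivI[OF inv] in auto)
  then show ?case using inv unfolding C_k_on_Suc differentiable_def by blast
qed

lemma smooth_on_cong: "open S \<Longrightarrow> (\<And>x. x \<in> S \<Longrightarrow> f x = g x) \<Longrightarrow> smooth_on f S \<longleftrightarrow> smooth_on g S"
  unfolding smooth_on_def using C_k_on_cong by blast

lemma smooth_on_const [simp, intro]: "smooth_on (\<lambda>x. c) S"
  by (simp add: smooth_on_def C_k_on_const)

lemma smooth_on_add [intro]:
  "open S \<Longrightarrow> smooth_on f S \<Longrightarrow> smooth_on g S \<Longrightarrow> smooth_on (\<lambda>x. f x + g x) S"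
  by (simp add: smooth_on_def C_k_on_add)

lemma smooth_on_bilinear:
  "bounded_bilinear p \<Longrightarrow> open S \<Longrightarrow> smooth_on f S \<Longrightarrow> smooth_on g S \<Longrightarrow> smooth_on (\<lambda>x. p (f x) (g x)) S"
  by (simp add: smooth_on_def C_k_on_bilinear)

lemmas smooth_on_inner [intro] = smooth_on_bilinear[OF bounded_bilinear_inner]
lemmas smooth_on_scaleR [intro] = smooth_on_bilinear[OF bounded_bilinear_scaleR]
lemmas smooth_on_mult [intro] =
  smooth_on_bilinear[OF bounded_bilinear_mult[where 'a=real]]

lemma smooth_on_minus [intro]:
  assumes "open S" "smooth_on f S"
  shows "smooth_on (\<lambda>x. - f x) S"
  using smooth_on_scaleR[OF assms(1) smooth_on_const[of "-1"] assms(2)] by simp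

lemma smooth_on_diff [intro]:
  assumes "open S" "smooth_on f S" "smooth_on g S"
  shows "smooth_on (\<lambda>x. f x - g x) S"
  using smooth_on_add[OF assms(1,2) smooth_on_minus[OF assms(1,3)]] by simp

lemma smooth_on_inverse [intro]:
  fixes f :: "'a::real_normed_vector \<Rightarrow> real"
  shows "open S \<Longrightarrow> smooth_on f S \<Longrightarrow> (\<And>x. x \<in> S \<Longrightarrow> f x \<noteq> 0) \<Longrightarrow> smooth_on (\<lambda>x. inverse (f x)) S"
  by (simp add: smooth_on_def C_k_on_inverse)

lemma smooth_on_subset: "smooth_on f S \<Longrightarrow> T \<subseteq> S \<Longrightarrow> smooth_on f T"
proof -
  have "C_k_on k f S \<Longrightarrow> T \<subseteq> S \<Longrightarrow> C_k_on k f T" for k and f :: "'a \<Rightarrow> 'b"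
    by (induction k arbitrary: f) (auto intro: continuous_on_subset)
  then show "smooth_on f S \<Longrightarrow> T \<subseteq> S \<Longrightarrow> smooth_on f T"
    unfolding smooth_on_def by blast
qed

lemma smooth_on_differentiable: "smooth_on f S \<Longrightarrow> u \<in> S \<Longrightarrow> f differentiable (at u)"
  unfolding smooth_on_def using C_k_on_Suc by blast

lemma smooth_on_vderiv [intro]: "smooth_on f S \<Longrightarrow> smooth_on (vderiv v f) S"
  unfolding smooth_on_def using C_k_on_Suc by blast

lemma smooth_on_continuous: "smooth_on f S \<Longrightarrow> continuous_on S f"
  unfolding smooth_on_def using C_k_on.simps(1) by blast

section \<open>Second derivatives\<close>

text \<open>The mean value theorem, applied first along \<open>v\<close> and then along \<open>w\<close>. The second difference is
  symmetric in the two directions, so comparing the two orders of application gives the symmetry of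
  second derivatives in the limit.\<close>

lemma second_difference:
  fixes f :: "'a::real_normed_vector \<Rightarrow> real"
  assumes S: "open S" and f: "smooth_on f S" and h: "0 < h"
    and box: "\<And>s t. 0 \<le> s \<Longrightarrow> s \<le> h \<Longrightarrow> 0 \<le> t \<Longrightarrow> t \<le> h \<Longrightarrow> u + s *\<^sub>R v + t *\<^sub>R w \<in> S"
  shows "\<exists>s t. 0 \<le> s \<and> s \<le> h \<and> 0 \<le> t \<and> t \<le> h \<and>
    f (u + h *\<^sub>R v + h *\<^sub>R w) - f (u + h *\<^sub>R v) - f (u + h *\<^sub>R w) + f u
      = h * h * vderiv w (vderiv v f) (u + s *\<^sub>R v + t *\<^sub>R w)"
proof -
  have line: "((\<lambda>r. g (a + r *\<^sub>R b)) has_real_derivative vderiv b g (a + r *\<^sub>R b)) (at r)"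
    if "smooth_on g S" "a + r *\<^sub>R b \<in> S" for g :: "'a \<Rightarrow> real" and a b r
  proof -
    have "(g has_derivative (\<lambda>v. vderiv v g (a + r *\<^sub>R b))) (at (a + r *\<^sub>R b))"
      using that by (intro has_derivative_vderiv smooth_on_differentiable)
    then have "((\<lambda>r. g (a + r *\<^sub>R b)) has_derivative (\<lambda>x. vderiv (x *\<^sub>R b) g (a + r *\<^sub>R b))) (at r)"
      by (rule has_derivative_compose[rotated]) (auto intro!: derivative_eq_intros)
    moreover have "vderiv (x *\<^sub>R b) g (a + r *\<^sub>R b) = vderiv b g (a + r *\<^sub>R b) * x" for x
      using linear_scale[OF linear_vderiv[OF smooth_on_differentiable[OF that]], of x b]
      by (simp only: real_scaleR_def mult.commute)
    ultimately show ?thesis by (simp add: has_field_derivative_def)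
  qed
  define A where "A s = f (u + s *\<^sub>R v + h *\<^sub>R w) - f (u + s *\<^sub>R v)" for s
  have "\<exists>s. 0 < s \<and> s < h \<and> A h - A 0 =
      (h - 0) * (vderiv v f (u + s *\<^sub>R v + h *\<^sub>R w) - vderiv v f (u + s *\<^sub>R v))"
  proof (rule MVT2[OF h])
    fix s assume s: "0 \<le> s" "s \<le> h"
    have "((\<lambda>s. f ((u + h *\<^sub>R w) + s *\<^sub>R v)) has_real_derivative vderiv v f ((u + h *\<^sub>R w) + s *\<^sub>R v)) (at s)"
      using box[of s h] s h by (intro line f) (simp add: algebra_simps)
    moreover have "((\<lambda>s. f (u + s *\<^sub>R v)) has_real_derivative vderiv v f (u + s *\<^sub>R v)) (at s)"
      using box[of s 0] s h by (intro line f) (simp add: algebra_simps)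
    ultimately show "(A has_real_derivative
        vderiv v f (u + s *\<^sub>R v + h *\<^sub>R w) - vderiv v f (u + s *\<^sub>R v)) (at s)"
      unfolding A_def by (auto intro!: DERIV_diff simp: add_ac)
  qed
  then obtain s where s: "0 < s" "s < h"
    "A h - A 0 = h * (vderiv v f (u + s *\<^sub>R v + h *\<^sub>R w) - vderiv v f (u + s *\<^sub>R v))" by auto
  have "\<exists>t. 0 < t \<and> t < h \<and> vderiv v f (u + s *\<^sub>R v + h *\<^sub>R w) - vderiv v f (u + s *\<^sub>R v + 0 *\<^sub>R w)
      = (h - 0) * vderiv w (vderiv v f) (u + s *\<^sub>R v + t *\<^sub>R w)"
    by (rule MVT2[OF h]) (use box s h f in \<open>auto intro!: line\<close>)
  then obtain t where "0 < t" "t < h" "vderiv v f (u + s *\<^sub>R v + h *\<^sub>R w) - vderiv v f (u + s *\<^sub>R v)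
      = h * vderiv w (vderiv v f) (u + s *\<^sub>R v + t *\<^sub>R w)" by auto
  then show ?thesis using s by (intro exI[of _ s] exI[of _ t]) (auto simp: A_def)
qed

lemma vderiv_commute_real:
  fixes f :: "'a::real_normed_vector \<Rightarrow> real"
  assumes S: "open S" and f: "smooth_on f S" and u: "u \<in> S"
  shows "vderiv v (vderiv w f) u = vderiv w (vderiv v f) u"
proof (rule ccontr)
  define g1 where "g1 = vderiv v (vderiv w f)"
  define g2 where "g2 = vderiv w (vderiv v f)"
  assume "vderiv v (vderiv w f) u \<noteq> vderiv w (vderiv v f) u"
  then have e: "dist (g1 u) (g2 u) / 2 > 0" (is "?e > 0") by (simp add: g1_def g2_def)
  have "isCont g1 u" "isCont g2 u"
    using smooth_on_continuous[of g1 S] smooth_on_continuous[of g2 S] f S u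
    by (auto simp: g1_def g2_def continuous_on_eq_continuous_at)
  then obtain d1 d2 where d: "d1 > 0" "\<And>x. dist x u < d1 \<Longrightarrow> dist (g1 x) (g1 u) < ?e"
    "d2 > 0" "\<And>x. dist x u < d2 \<Longrightarrow> dist (g2 x) (g2 u) < ?e"
    using e unfolding continuous_at_eps_delta by (metis dist_commute)
  obtain d3 where d3: "d3 > 0" "ball u d3 \<subseteq> S" using S u openE by blast
  define \<delta> where "\<delta> = min (min d1 d2) d3"
  define h where "h = \<delta> / (2 * (norm v + norm w + 1))"
  have pos: "norm v + norm w + 1 > 0" by (smt (verit) norm_ge_zero)
  have \<delta>: "\<delta> > 0" using d d3 by (auto simp: \<delta>_def)
  have h: "h > 0" using \<delta> pos by (simp add: h_def)
  have near: "dist (u + s *\<^sub>R v + t *\<^sub>R w) u < \<delta>" if "0 \<le> s" "s \<le> h" "0 \<le> t" "t \<le> h" for s t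
  proof -
    have "dist (u + s *\<^sub>R v + t *\<^sub>R w) u = norm (s *\<^sub>R v + t *\<^sub>R w)" by (simp add: dist_norm)
    also have "\<dots> \<le> s * norm v + t * norm w" using norm_triangle_ineq[of "s *\<^sub>R v" "t *\<^sub>R w"] that by simp
    also have "\<dots> \<le> h * norm v + h * norm w" using that by (intro add_mono mult_right_mono) auto
    also have "\<dots> < h * (2 * (norm v + norm w + 1))"
      using h by (auto simp: algebra_simps intro!: add_nonneg_pos)
    also have "\<dots> = \<delta>" using pos by (simp add: h_def)
    finally show ?thesis .
  qed
  have box: "u + s *\<^sub>R v + t *\<^sub>R w \<in> S" if "0 \<le> s" "s \<le> h" "0 \<le> t" "t \<le> h" for s t
    using near[OF that] d3 by (auto simp: \<delta>_def dist_commute)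
  obtain s t where 1: "0 \<le> s" "s \<le> h" "0 \<le> t" "t \<le> h"
    "f (u + h *\<^sub>R v + h *\<^sub>R w) - f (u + h *\<^sub>R v) - f (u + h *\<^sub>R w) + f u = h * h * g2 (u + s *\<^sub>R v + t *\<^sub>R w)"
    using second_difference[OF S f h box] unfolding g2_def by blast
  have box': "u + s *\<^sub>R w + t *\<^sub>R v \<in> S" if "0 \<le> s" "s \<le> h" "0 \<le> t" "t \<le> h" for s t
    using box[of t s] that by (simp add: add_ac)
  obtain s' t' where 2: "0 \<le> s'" "s' \<le> h" "0 \<le> t'" "t' \<le> h"
    "f (u + h *\<^sub>R w + h *\<^sub>R v) - f (u + h *\<^sub>R w) - f (u + h *\<^sub>R v) + f u = h * h * g1 (u + s' *\<^sub>R w + t' *\<^sub>R v)"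
    using second_difference[OF S f h box'] unfolding g1_def by blast
  have "f (u + h *\<^sub>R w + h *\<^sub>R v) = f (u + h *\<^sub>R v + h *\<^sub>R w)" by (simp add: add_ac)
  then have "h * h * g2 (u + s *\<^sub>R v + t *\<^sub>R w) = h * h * g1 (u + s' *\<^sub>R w + t' *\<^sub>R v)"
    using 1(5) 2(5) by linarith
  then have eq: "g2 (u + s *\<^sub>R v + t *\<^sub>R w) = g1 (u + t' *\<^sub>R v + s' *\<^sub>R w)" using h by (simp add: add_ac)
  have "dist (g2 (u + s *\<^sub>R v + t *\<^sub>R w)) (g2 u) < ?e" "dist (g1 (u + t' *\<^sub>R v + s' *\<^sub>R w)) (g1 u) < ?e"
    using near[of s t] near[of t' s'] 1 2 d by (auto simp: \<delta>_def)
  then show False using eq unfolding dist_real_def by (smt (verit) field_sum_of_halves)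
qed

lemma vderiv_inner_const:
  "f differentiable (at u) \<Longrightarrow> vderiv v (\<lambda>x. f x \<bullet> c) u = vderiv v f u \<bullet> (c::'b::real_inner)"
  using vderiv_inner[of f u "\<lambda>x. c" v] by simp

lemma vderiv_commute:
  fixes f :: "'a::real_normed_vector \<Rightarrow> 'b::real_inner"
  assumes S: "open S" and f: "smooth_on f S" and u: "u \<in> S"
  shows "vderiv v (vderiv w f) u = vderiv w (vderiv v f) u"
proof -
  have *: "vderiv v (vderiv w (\<lambda>x. f x \<bullet> c)) u = vderiv v (vderiv w f) u \<bullet> c" for v w c
  proof -
    have "vderiv v (vderiv w (\<lambda>x. f x \<bullet> c)) u = vderiv v (\<lambda>x. vderiv w f x \<bullet> c) u"
      using f by (intro vderiv_cong_open[OF S u] vderiv_inner_const smooth_on_differentiable[of _ S])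
    also have "\<dots> = vderiv v (vderiv w f) u \<bullet> c"
      using f u by (intro vderiv_inner_const smooth_on_differentiable[of _ S] smooth_on_vderiv)
    finally show ?thesis .
  qed
  have "smooth_on (\<lambda>x. f x \<bullet> c) S" for c
    by (rule smooth_on_inner[OF S f smooth_on_const])
  from vderiv_commute_real[OF S this u, of v w] have "vderiv v (vderiv w f) u \<bullet> c = vderiv w (vderiv v f) u \<bullet> c" for c
    unfolding * .
  then show ?thesis using vector_eq_rdot by blast
qed

lemma linear_vderiv_vderiv:
  fixes g :: "'a::real_normed_vector \<Rightarrow> 'b::real_inner"
  assumes "open U" "smooth_on g U" "u \<in> U"
  shows "linear (\<lambda>v. vderiv v (vderiv w g) u)" "linear (\<lambda>w. vderiv v (vderiv w g) u)"
proof -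
  show *: "linear (\<lambda>v. vderiv v (vderiv w g) u)" for w
    using assms by (intro linear_vderiv smooth_on_differentiable[of _ U] smooth_on_vderiv)
  show "linear (\<lambda>w. vderiv v (vderiv w g) u)"
    using *[of v] unfolding vderiv_commute[OF assms, of v] .
qed

lemma vderiv_compose:
  assumes "g differentiable (at (\<psi> u))" "\<psi> differentiable (at u)"
  shows "vderiv v (\<lambda>w. g (\<psi> w)) u = vderiv (vderiv v \<psi> u) g (\<psi> u)"
  by (rule vderivI[OF has_derivative_compose[OF has_derivative_vderiv[OF assms(2)] has_derivative_vderiv[OF assms(1)]]])

lemma vderiv_zero_imp_constant:
  assumes "open V" "connected V" "\<And>x. x \<in> V \<Longrightarrow> g differentiable (at x)"
    and "\<And>x v. x \<in> V \<Longrightarrow> vderiv v g x = 0" "x \<in> V" "y \<in> V"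
  shows "g x = g y"
proof (rule has_derivative_zero_unique_connected[OF assms(1,2) _ assms(5,6)])
  fix x assume "x \<in> V"
  then show "(g has_derivative (\<lambda>x. 0)) (at x)"
    using has_derivative_vderiv[OF assms(3)] assms(4) by simp
qed

lemma vderiv_orth:
  fixes a b :: "'a::real_normed_vector \<Rightarrow> 'b::real_inner"
  assumes "open S" "u \<in> S" "\<And>x. x \<in> S \<Longrightarrow> a x \<bullet> b x = 0"
    and "a differentiable (at u)" "b differentiable (at u)"
  shows "vderiv v a u \<bullet> b u = - (a u \<bullet> vderiv v b u)"
proof -
  have "vderiv v (\<lambda>x. a x \<bullet> b x) u = vderiv v (\<lambda>x. 0) u"
    by (rule vderiv_cong_open[OF assms(1,2)]) (rule assms(3))
  then show ?thesis unfolding vderiv_inner[OF assms(4,5)] vderiv_const by simp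
qed

lemma vderiv_orth_twice:
  fixes a b :: "'a::real_normed_vector \<Rightarrow> 'b::real_inner"
  assumes U: "open U" and u: "u \<in> U" and orth: "\<And>x. x \<in> U \<Longrightarrow> a x \<bullet> b x = 0"
    and a: "smooth_on a U" and b: "smooth_on b U"
  shows "vderiv v (vderiv w a) u \<bullet> b u + vderiv w a u \<bullet> vderiv v b u
    + vderiv v a u \<bullet> vderiv w b u + a u \<bullet> vderiv v (vderiv w b) u = 0"
proof -
  note d = smooth_on_differentiable[OF a] smooth_on_differentiable[OF b]
    smooth_on_differentiable[OF smooth_on_vderiv[OF a]] smooth_on_differentiable[OF smooth_on_vderiv[OF b]]
  have 1: "vderiv w (\<lambda>x. a x \<bullet> b x) x = 0" if "x \<in> U" for x
    using vderiv_cong_open[OF U that orth] by simp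
  have sm: "smooth_on (\<lambda>x. a x \<bullet> vderiv w b x) U" "smooth_on (\<lambda>x. vderiv w a x \<bullet> b x) U"
    by (intro smooth_on_inner[OF U] smooth_on_vderiv a b)+
  have "vderiv v (\<lambda>x. a x \<bullet> vderiv w b x + vderiv w a x \<bullet> b x) u = 0"
    using vderiv_cong_open[OF U u, of "\<lambda>x. a x \<bullet> vderiv w b x + vderiv w a x \<bullet> b x" "\<lambda>x. 0"] 1
    by (simp add: vderiv_inner d)
  then show ?thesis
    unfolding vderiv_add[OF smooth_on_differentiable[OF sm(1) u] smooth_on_differentiable[OF sm(2) u]]
      vderiv_inner[OF d(1)[OF u] d(4)[OF u]] vderiv_inner[OF d(3)[OF u] d(2)[OF u]] by simp
qed

text \<open>If \<open>a\<close> is a multiple of \<open>b\<close> near \<open>u\<close> and vanishes at \<open>u\<close>, then so are its derivatives at \<open>u\<close>, since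
  the derivative of the direction \<open>b\<close> is multiplied by the vanishing coefficient. The relation is
  stated without division, so that both sides are smooth.\<close>

lemma vderiv_parallel_at_zero:
  fixes a b :: "'a::real_normed_vector \<Rightarrow> 'b::real_inner"
  assumes U: "open U" and u: "u \<in> U"
    and par: "\<And>x. x \<in> U \<Longrightarrow> (b x \<bullet> b x) *\<^sub>R a x = (a x \<bullet> b x) *\<^sub>R b x"
    and a: "smooth_on a U" and b: "smooth_on b U" and 0: "a u = 0"
  shows "(b u \<bullet> b u) *\<^sub>R vderiv v a u = (vderiv v a u \<bullet> b u) *\<^sub>R b u"
proof -
  note d = smooth_on_differentiable[OF a u] smooth_on_differentiable[OF b u]
  have "vderiv v (\<lambda>x. (b x \<bullet> b x) *\<^sub>R a x) u = vderiv v (\<lambda>x. (a x \<bullet> b x) *\<^sub>R b x) u"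
    by (rule vderiv_cong_open[OF U u par])
  moreover have "vderiv v (\<lambda>x. (b x \<bullet> b x) *\<^sub>R a x) u = (b u \<bullet> b u) *\<^sub>R vderiv v a u"
    using vderiv_bilinear[OF bounded_bilinear_scaleR smooth_on_differentiable[OF smooth_on_inner[OF U b b] u] d(1), of v]
    by (simp add: 0)
  moreover have "vderiv v (\<lambda>x. (a x \<bullet> b x) *\<^sub>R b x) u = (vderiv v a u \<bullet> b u) *\<^sub>R b u"
    using vderiv_bilinear[OF bounded_bilinear_scaleR smooth_on_differentiable[OF smooth_on_inner[OF U a b] u] d(2), of v]
      vderiv_inner[OF d, of v] by (simp add: 0)
  ultimately show ?thesis by simp
qed

section \<open>Orthonormal frames and metric traces\<close>

text \<open>Applied to the differential \<open>L\<close> of an immersion: \<open>X\<close> and \<open>Y\<close> are vectors of the parameter plane that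
  are orthonormal for the induced metric.\<close>

definition ortho_frame :: "(real ^ 2 \<Rightarrow> 'e::real_inner) \<Rightarrow> real ^ 2 \<Rightarrow> real ^ 2 \<Rightarrow> bool" where
  "ortho_frame L X Y \<longleftrightarrow> L X \<bullet> L X = 1 \<and> L Y \<bullet> L Y = 1 \<and> L X \<bullet> L Y = 0"

text \<open>The Gram-Schmidt process for the two coordinate vectors.\<close>

lemma ortho_frame_exists:
  fixes L :: "real ^ 2 \<Rightarrow> 'e::real_inner"
  assumes "linear L" "inj L"
  shows "\<exists>X Y. ortho_frame L X Y"
proof -
  have L0: "L v \<noteq> 0" if "v \<noteq> 0" for v
    using assms that by (metis injD linear_0)
  have normalize: "L ((1 / norm (L v)) *\<^sub>R v) \<bullet> L ((1 / norm (L v)) *\<^sub>R v) = 1" if "v \<noteq> 0" for v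
    using L0[OF that] by (simp add: linear_scale[OF assms(1)] dot_square_norm power2_eq_square)
  define X where "X = (1 / norm (L (axis 1 1))) *\<^sub>R (axis 1 1 :: real ^ 2)"
  have X: "L X \<bullet> L X = 1" unfolding X_def by (rule normalize) (simp add: axis_eq_0_iff)
  define Z where "Z = axis 2 1 - (L (axis 2 1) \<bullet> L X) *\<^sub>R X"
  have "Z $ 2 = 1" by (simp add: Z_def X_def axis_def)
  then have Z: "Z \<noteq> 0" by auto
  have "L Z \<bullet> L X = 0"
    by (simp add: Z_def linear_diff[OF assms(1)] linear_scale[OF assms(1)] inner_diff_left X)
  then have "L X \<bullet> L ((1 / norm (L Z)) *\<^sub>R Z) = 0"
    by (simp add: linear_scale[OF assms(1)] inner_commute)
  then show ?thesis using X normalize[OF Z] unfolding ortho_frame_def by blast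
qed

lemma ortho_frame_expand:
  fixes L :: "real ^ 2 \<Rightarrow> 'e::real_inner"
  assumes L: "linear L" and XY: "ortho_frame L X Y"
  shows "v = (L v \<bullet> L X) *\<^sub>R X + (L v \<bullet> L Y) *\<^sub>R Y"
proof -
  have *: "L (a *\<^sub>R X + b *\<^sub>R Y) \<bullet> L X = a" "L (a *\<^sub>R X + b *\<^sub>R Y) \<bullet> L Y = b" for a b
    using XY by (simp_all add: linear_add[OF L] linear_scale[OF L] ortho_frame_def inner_add_left inner_add_right inner_commute)
  have "X \<noteq> Y" using XY by (auto simp: ortho_frame_def)
  have "independent {X, Y}"
    unfolding independent_explicit_finite_subsets
  proof (intro allI impI ballI)
    fix S u v assume S: "S \<subseteq> {X, Y}" "finite S" and s: "(\<Sum>v\<in>S. u v *\<^sub>R v) = 0" and v: "v \<in> S"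
    define w where "w v = (if v \<in> S then u v else 0)" for v
    have "(\<Sum>v\<in>S. u v *\<^sub>R v) = (\<Sum>v\<in>{X, Y}. w v *\<^sub>R v)"
      unfolding w_def by (rule sum.mono_neutral_cong_left) (use S in auto)
    then have "w X *\<^sub>R X + w Y *\<^sub>R Y = 0" using s \<open>X \<noteq> Y\<close> by simp
    then have "w X = 0" "w Y = 0" using *[of "w X" "w Y"] linear_0[OF L] by auto
    then show "u v = 0" using v S by (auto simp: w_def split: if_splits)
  qed
  then have "span {X, Y} = (UNIV :: (real ^ 2) set)"
    using card_ge_dim_independent[of "{X, Y}" UNIV] \<open>X \<noteq> Y\<close> by (simp add: dim_UNIV top.extremum_unique)
  then have "v \<in> span {X, Y}" by simp
  then obtain a b where "v - a *\<^sub>R X = b *\<^sub>R Y"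
    by (auto simp: span_breakdown_eq)
  then have "v = a *\<^sub>R X + b *\<^sub>R Y" by (simp add: algebra_simps)
  then show ?thesis using *[of a b] by simp
qed

text \<open>Connects the tangent plane as the span of the partial derivatives, which occurs in the definition
  of the normal part, with its orthonormal basis.\<close>

lemma ortho_frame_span:
  fixes L :: "real ^ 2 \<Rightarrow> 'e::real_inner"
  assumes L: "linear L" and XY: "ortho_frame L X Y"
  shows "span (range (\<lambda>k. L (axis k 1))) = range L"
    and "range L = {a *\<^sub>R L X + b *\<^sub>R L Y |a b. True}"
proof -
  have v: "L v = (\<Sum>k\<in>UNIV. v $ k *\<^sub>R L (axis k 1))" for v
  proof -
    have "L v = L (\<Sum>k\<in>UNIV. v $ k *\<^sub>R axis k 1)"
      using basis_expansion[of v] by (simp only: scalar_mult_eq_scaleR)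
    then show ?thesis by (simp add: linear_sum[OF L] linear_scale[OF L])
  qed
  show "span (range (\<lambda>k. L (axis k 1))) = range L"
  proof
    show "span (range (\<lambda>k. L (axis k 1))) \<subseteq> range L"
      by (rule span_minimal) (auto intro: linear_subspace_image[OF L])
    show "range L \<subseteq> span (range (\<lambda>k. L (axis k 1)))"
    proof clarify
      fix w show "L w \<in> span (range (\<lambda>k. L (axis k 1)))"
        unfolding v[of w] by (intro span_sum span_scale span_base rangeI)
    qed
  qed
  show "range L = {a *\<^sub>R L X + b *\<^sub>R L Y |a b. True}"
  proof (intro equalityI subsetI)
    fix w assume "w \<in> range L"
    then obtain v where "w = L v" by auto
    then have "w = L ((L v \<bullet> L X) *\<^sub>R X + (L v \<bullet> L Y) *\<^sub>R Y)" using ortho_frame_expand[OF L XY, of v] by simp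
    then show "w \<in> {a *\<^sub>R L X + b *\<^sub>R L Y |a b. True}" by (auto simp: linear_add[OF L] linear_scale[OF L])
  next
    fix w assume "w \<in> {a *\<^sub>R L X + b *\<^sub>R L Y |a b. True}"
    then obtain a b where "w = L (a *\<^sub>R X + b *\<^sub>R Y)" by (auto simp: linear_add[OF L] linear_scale[OF L])
    then show "w \<in> range L" by auto
  qed
qed

lemma orth_proj_frame:
  fixes L :: "real ^ 2 \<Rightarrow> 'e::real_inner"
  assumes L: "linear L" and XY: "ortho_frame L X Y"
  shows "orth_proj (span (range (\<lambda>k. L (axis k 1)))) w = (w \<bullet> L X) *\<^sub>R L X + (w \<bullet> L Y) *\<^sub>R L Y"
proof (rule orth_proj_unique)
  show "(w \<bullet> L X) *\<^sub>R L X + (w \<bullet> L Y) *\<^sub>R L Y \<in> span (range (\<lambda>k. L (axis k 1)))"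
    unfolding ortho_frame_span[OF assms] by blast
  fix s assume "s \<in> span (range (\<lambda>k. L (axis k 1)))"
  then obtain a b where "s = a *\<^sub>R L X + b *\<^sub>R L Y" unfolding ortho_frame_span[OF assms] by blast
  then show "(w - ((w \<bullet> L X) *\<^sub>R L X + (w \<bullet> L Y) *\<^sub>R L Y)) \<bullet> s = 0"
    using XY by (simp add: ortho_frame_def inner_diff_left inner_add_left inner_add_right inner_commute inner_diff_right)
qed simp

lemma matrix_inv_eq:
  fixes A :: "real ^ 'n ^ 'n"
  assumes "B ** A = mat 1"
  shows "matrix_inv A = B"
proof -
  have AB: "A ** B = mat 1" using assms matrix_left_right_inverse by blast
  have "A ** matrix_inv A = mat 1 \<and> matrix_inv A ** A = mat 1"
    unfolding matrix_inv_def by (rule someI[of _ B]) (use assms AB in blast)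
  then show ?thesis
    using matrix_mul_assoc[of B A "matrix_inv A"] assms by simp
qed

lemma vec2_expand: "v = v $ 1 *\<^sub>R axis 1 1 + v $ 2 *\<^sub>R (axis 2 1 :: real ^ 2)"
  by (simp add: vec_eq_iff forall_2 axis_def)

text \<open>If \<open>M\<close> has the columns \<open>X\<close> and \<open>Y\<close> and \<open>G\<close> is the Gram matrix, then \<open>M\<^sup>T G M = 1\<close>, hence
  \<open>G\<^sup>-\<^sup>1 = M M\<^sup>T\<close>. Reading this off in coordinates turns contractions with the inverse metric into sums
  over the frame.\<close>

lemma frame_matrix_inverse:
  fixes L :: "real ^ 2 \<Rightarrow> 'e::real_inner"
  assumes L: "linear L" and XY: "ortho_frame L X Y"
  shows "(\<chi> i j. X $ i * X $ j + Y $ i * Y $ j) ** (\<chi> i j. L (axis i 1) \<bullet> L (axis j 1)) = mat 1"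
proof -
  define K :: "real ^ 2 ^ 2" where "K = (\<chi> i j. X $ i * X $ j + Y $ i * Y $ j)"
  have comb: "Z $ 1 * (L (axis 1 1) \<bullet> w) + Z $ 2 * (L (axis 2 1) \<bullet> w) = L Z \<bullet> w" for Z w
  proof -
    have "L Z = L (Z $ 1 *\<^sub>R axis 1 1 + Z $ 2 *\<^sub>R axis 2 1)" using vec2_expand[of Z] by simp
    then show ?thesis by (simp add: linear_add[OF L] linear_scale[OF L] inner_add_left)
  qed
  have "K ** (\<chi> i j. L (axis i 1) \<bullet> L (axis j 1)) = mat 1"
  proof (unfold vec_eq_iff, intro allI)
    fix i j :: 2
    have "(X $ i * X $ 1 + Y $ i * Y $ 1) * (L (axis 1 1) \<bullet> L (axis j 1)) +
        (X $ i * X $ 2 + Y $ i * Y $ 2) * (L (axis 2 1) \<bullet> L (axis j 1))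
        = X $ i * (L X \<bullet> L (axis j 1)) + Y $ i * (L Y \<bullet> L (axis j 1))"
      unfolding comb[of X "L (axis j 1)", symmetric] comb[of Y "L (axis j 1)", symmetric]
      by (simp only: ring_distribs mult_ac add_ac)
    also have "\<dots> = ((L (axis j 1) \<bullet> L X) *\<^sub>R X + (L (axis j 1) \<bullet> L Y) *\<^sub>R Y) $ i"
      by (simp add: inner_commute)
    also have "\<dots> = axis j 1 $ i" using ortho_frame_expand[OF assms, of "axis j 1"] by simp
    finally show "(K ** (\<chi> i j. L (axis i 1) \<bullet> L (axis j 1))) $ i $ j = mat 1 $ i $ j"
      by (simp add: axis_def matrix_matrix_mult_def sum_2 K_def mat_def)
  qed
  then show ?thesis by (simp add: K_def)
qed

lemma matrix_inv_frame:
  fixes L :: "real ^ 2 \<Rightarrow> 'e::real_inner"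
  assumes L: "linear L" and XY: "ortho_frame L X Y"
  shows "matrix_inv (\<chi> i j. L (axis i 1) \<bullet> L (axis j 1)) $ i $ j = X $ i * X $ j + Y $ i * Y $ j"
  unfolding matrix_inv_eq[OF frame_matrix_inverse[OF assms]] by simp

text \<open>Frames cannot be used to see that the inverse metric depends smoothly on the point, because they
  are chosen pointwise; Cramer's rule shows it. The index \<open>3 - i\<close> is the index different from \<open>i\<close>.\<close>

lemma matrix_inv_2:
  fixes A :: "real ^ 2 ^ 2"
  assumes "det A \<noteq> 0"
  shows "matrix_inv A = (\<chi> i j. (if i = j then A $ (3 - i) $ (3 - i) else - A $ i $ j) * inverse (det A))"
proof (rule matrix_inv_eq)
  have "(A $ 1 $ 1 * A $ 2 $ 2 - A $ 1 $ 2 * A $ 2 $ 1) * inverse (det A) = 1"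
    using assms by (simp add: det_2)
  then show "(\<chi> i j. (if i = j then A $ (3 - i) $ (3 - i) else - A $ i $ j) * inverse (det A)) ** A = mat 1"
    by (simp add: vec_eq_iff forall_2 matrix_matrix_mult_def sum_2 mat_def algebra_simps)
qed

lemma metric_trace_frame:
  fixes L :: "real ^ 2 \<Rightarrow> 'e::real_inner" and b :: "real ^ 2 \<Rightarrow> real ^ 2 \<Rightarrow> 'f::real_vector"
  assumes L: "linear L" and XY: "ortho_frame L X Y"
    and b: "\<And>v. linear (b v)" "\<And>w. linear (\<lambda>v. b v w)"
  shows "metric_trace (\<chi> i j. L (axis i 1) \<bullet> L (axis j 1)) (\<lambda>i j. b (axis i 1) (axis j 1)) = b X X + b Y Y"
proof -
  have exp: "b Z Z = (Z $ 1 * Z $ 1) *\<^sub>R b (axis 1 1) (axis 1 1) + (Z $ 1 * Z $ 2) *\<^sub>R b (axis 1 1) (axis 2 1)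
     + (Z $ 2 * Z $ 1) *\<^sub>R b (axis 2 1) (axis 1 1) + (Z $ 2 * Z $ 2) *\<^sub>R b (axis 2 1) (axis 2 1)" for Z
  proof -
    have "b Z Z = b Z (Z $ 1 *\<^sub>R axis 1 1 + Z $ 2 *\<^sub>R axis 2 1)"
      using vec2_expand[of Z] by simp
    also have "\<dots> = Z $ 1 *\<^sub>R b Z (axis 1 1) + Z $ 2 *\<^sub>R b Z (axis 2 1)"
      by (simp only: linear_add[OF b(1)] linear_scale[OF b(1)])
    finally have exp2: "b Z Z = Z $ 1 *\<^sub>R b Z (axis 1 1) + Z $ 2 *\<^sub>R b Z (axis 2 1)" .
    have exp1: "b Z w = Z $ 1 *\<^sub>R b (axis 1 1) w + Z $ 2 *\<^sub>R b (axis 2 1) w" for w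
    proof -
      have "b Z w = b (Z $ 1 *\<^sub>R axis 1 1 + Z $ 2 *\<^sub>R axis 2 1) w"
        using vec2_expand[of Z] by simp
      then show ?thesis by (simp only: linear_add[OF b(2)] linear_scale[OF b(2)])
    qed
    show ?thesis unfolding exp2 exp1[of "axis 1 1"] exp1[of "axis 2 1"]
      by (simp only: scaleR_add_right scaleR_scaleR add_ac mult.commute)
  qed
  show ?thesis
    unfolding exp[of X] exp[of Y] metric_trace_def matrix_inv_frame[OF L XY] sum_2
    by (simp only: scaleR_add_left add_ac)
qed

section \<open>Round spheres\<close>

lemma has_vector_derivative_imp_inner_0:
  fixes \<gamma> :: "real \<Rightarrow> 'e::real_inner"
  assumes "(\<gamma> has_vector_derivative v) (at 0)" "\<And>t. (\<gamma> t - z) \<bullet> (\<gamma> t - z) = c"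
  shows "v \<bullet> (\<gamma> 0 - z) = 0"
proof -
  have "((\<lambda>t. (\<gamma> t - z) \<bullet> (\<gamma> t - z)) has_vector_derivative (\<gamma> 0 - z) \<bullet> v + v \<bullet> (\<gamma> 0 - z)) (at 0)"
    using assms(1) unfolding has_vector_derivative_def
    by (auto intro!: derivative_eq_intros simp: algebra_simps)
  moreover have "((\<lambda>t. (\<gamma> t - z) \<bullet> (\<gamma> t - z)) has_vector_derivative 0) (at 0)"
    unfolding assms(2) by simp
  ultimately have "(\<gamma> 0 - z) \<bullet> v + v \<bullet> (\<gamma> 0 - z) = 0"
    by (rule vector_derivative_unique_at)
  then show ?thesis by (simp add: inner_commute)
qed

text \<open>Covers the unit sphere (with \<open>a = 0\<close> and \<open>b = 0\<close>) and its hyperspheres together. A vector that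
  satisfies the two equations is the velocity of a great circle of the section, run through with speed
  \<open>|v|\<close>.\<close>

lemma tangent_space_round_sphere:
  fixes a z p :: "'e::real_inner" and r b :: real
  defines "S \<equiv> sphere z r \<inter> {x. a \<bullet> x = b}"
  assumes az: "a \<bullet> z = b" and r: "r > 0" and p: "p \<in> S"
  shows "tangent_space S p = {v. v \<bullet> (p - z) = 0 \<and> v \<bullet> a = 0}"
proof (intro equalityI subsetI)
  fix v assume "v \<in> tangent_space S p"
  then obtain \<gamma> where \<gamma>: "range \<gamma> \<subseteq> S" "\<gamma> 0 = p" "(\<gamma> has_vector_derivative v) (at 0)"
    by (auto simp: tangent_space_def curve_at_def)
  have mem: "\<gamma> t \<in> S" for t using \<gamma>(1) by auto
  have "(\<gamma> t - z) \<bullet> (\<gamma> t - z) = r\<^sup>2" for t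
    using mem[of t] by (simp add: S_def dist_norm norm_minus_commute dot_square_norm)
  from has_vector_derivative_imp_inner_0[OF \<gamma>(3) this] have "v \<bullet> (p - z) = 0" using \<gamma>(2) by simp
  moreover have "v \<bullet> a = 0"
  proof -
    have "((\<lambda>t. a \<bullet> \<gamma> t) has_vector_derivative a \<bullet> v) (at 0)"
      using \<gamma>(3) unfolding has_vector_derivative_def by (auto intro!: derivative_eq_intros)
    moreover have "((\<lambda>t. a \<bullet> \<gamma> t) has_vector_derivative 0) (at 0)"
      using mem by (simp add: S_def)
    ultimately have "a \<bullet> v = 0" by (rule vector_derivative_unique_at)
    then show ?thesis by (simp add: inner_commute)
  qed
  ultimately show "v \<in> {v. v \<bullet> (p - z) = 0 \<and> v \<bullet> a = 0}" by simp
next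
  fix v assume "v \<in> {v. v \<bullet> (p - z) = 0 \<and> v \<bullet> a = 0}"
  then have v: "v \<bullet> (p - z) = 0" "v \<bullet> a = 0" by auto
  have pz: "(p - z) \<bullet> (p - z) = r\<^sup>2" "a \<bullet> (p - z) = 0"
    using p az by (auto simp: S_def dist_norm norm_minus_commute dot_square_norm inner_diff_right)
  show "v \<in> tangent_space S p"
  proof (cases "v = 0")
    case True
    have "curve_at S p v (\<lambda>t. p)" using p True by (auto simp: curve_at_def)
    then show ?thesis by (auto simp: tangent_space_def)
  next
    case False
    \<comment> \<open>the angular velocity on a circle of radius \<open>r\<close>\<close>
    define k where "k = norm v / r"
    have k: "k \<noteq> 0" "v \<bullet> v = k\<^sup>2 * r\<^sup>2" using False r by (auto simp: k_def dot_square_norm power_divide)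
    define \<gamma> where "\<gamma> t = z + cos (k * t) *\<^sub>R (p - z) + (sin (k * t) / k) *\<^sub>R v" for t
    have "(\<gamma> t - z) \<bullet> (\<gamma> t - z) = r\<^sup>2" for t
    proof -
      have "\<gamma> t - z = cos (k * t) *\<^sub>R (p - z) + (sin (k * t) / k) *\<^sub>R v" by (simp add: \<gamma>_def)
      moreover have "(x *\<^sub>R (p - z) + y *\<^sub>R v) \<bullet> (x *\<^sub>R (p - z) + y *\<^sub>R v) = x\<^sup>2 * r\<^sup>2 + y\<^sup>2 * (k\<^sup>2 * r\<^sup>2)" for x y
      proof -
        have "(p - z) \<bullet> v = 0" using v(1) by (simp add: inner_commute)
        then show ?thesis
          by (simp only: inner_add_left inner_add_right inner_scaleR_left inner_scaleR_right pz(1) k(2) v(1))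
            (simp add: power2_eq_square)
      qed
      ultimately have "(\<gamma> t - z) \<bullet> (\<gamma> t - z) = (cos (k * t))\<^sup>2 * r\<^sup>2 + (sin (k * t) / k)\<^sup>2 * (k\<^sup>2 * r\<^sup>2)"
        by simp
      also have "\<dots> = ((cos (k * t))\<^sup>2 + (sin (k * t))\<^sup>2) * r\<^sup>2"
      proof -
        have "(sin (k * t) / k)\<^sup>2 * (k\<^sup>2 * r\<^sup>2) = (sin (k * t))\<^sup>2 * r\<^sup>2"
          using k(1) by (simp add: power_divide)
        then show ?thesis by (simp only: distrib_right)
      qed
      finally show ?thesis by simp
    qed
    then have "norm (\<gamma> t - z) = r" for t using r by (simp add: norm_eq_sqrt_inner)
    moreover have "a \<bullet> \<gamma> t = b" for t
      using pz(2) v(2) az by (simp add: \<gamma>_def inner_add_right inner_commute[of a v])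
    ultimately have "\<gamma> t \<in> S" for t by (simp add: S_def dist_norm norm_minus_commute)
    moreover have "(\<gamma> has_vector_derivative v) (at 0)"
      unfolding \<gamma>_def has_vector_derivative_def using k(1)
      by (auto intro!: derivative_eq_intros)
    ultimately have "curve_at S p v \<gamma>" by (auto simp: curve_at_def \<gamma>_def)
    then show ?thesis by (auto simp: tangent_space_def)
  qed
qed

lemma tangent_space_sphere:
  fixes p :: "'e::real_inner"
  assumes "norm p = 1"
  shows "tangent_space (sphere 0 1) p = {v. v \<bullet> p = 0}"
  using tangent_space_round_sphere[of 0 0 0 1 p] assms by simp

lemma tan_proj_two_normals:
  fixes n1 n2 :: "'e::real_inner"
  assumes "tangent_space N p = {v. v \<bullet> n1 = 0 \<and> v \<bullet> n2 = 0}"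
    and "n1 \<bullet> n1 = 1" "n2 \<bullet> n2 = 1" "n1 \<bullet> n2 = 0"
  shows "tan_proj N p w = w - (w \<bullet> n1) *\<^sub>R n1 - (w \<bullet> n2) *\<^sub>R n2"
  unfolding tan_proj_def assms(1)
proof (rule orth_proj_unique)
  have "n2 \<bullet> n1 = 0" using assms(4) by (simp add: inner_commute)
  then show "w - (w \<bullet> n1) *\<^sub>R n1 - (w \<bullet> n2) *\<^sub>R n2 \<in> {v. v \<bullet> n1 = 0 \<and> v \<bullet> n2 = 0}"
    using assms(2-4) by (simp add: inner_diff_left)
  fix s assume "s \<in> {v. v \<bullet> n1 = 0 \<and> v \<bullet> n2 = 0}"
  then have "n1 \<bullet> s = 0" "n2 \<bullet> s = 0" by (auto simp: inner_commute)
  then show "(w - (w - (w \<bullet> n1) *\<^sub>R n1 - (w \<bullet> n2) *\<^sub>R n2)) \<bullet> s = 0" by (simp add: inner_add_left)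
qed (simp add: subspace_def inner_add_left)

lemma tan_proj_sphere:
  fixes p :: "'e::real_inner"
  assumes "norm p = 1"
  shows "tan_proj (sphere 0 1) p w = w - (w \<bullet> p) *\<^sub>R p"
  unfolding tan_proj_def tangent_space_sphere[OF assms]
proof (rule orth_proj_unique)
  show "w - (w \<bullet> p) *\<^sub>R p \<in> {v. v \<bullet> p = 0}"
    using assms by (simp add: inner_diff_left dot_square_norm)
  fix s assume "s \<in> {v. v \<bullet> p = 0}"
  then have "p \<bullet> s = 0" by (simp add: inner_commute)
  then show "(w - (w - (w \<bullet> p) *\<^sub>R p)) \<bullet> s = 0" by simp
qed (simp add: subspace_def inner_add_left)

text \<open>The directional derivative of a field given on \<open>N\<close> can be computed from any differentiable
  extension; this needs a curve with velocity \<open>v\<close>, so that the defining property determines the value.\<close>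

lemma dir_deriv_eq:
  fixes Z :: "'e::real_normed_vector \<Rightarrow> 'e"
  assumes v: "v \<in> tangent_space N p"
    and ext: "\<And>q. q \<in> N \<Longrightarrow> Y q = Z q" and Z: "(Z has_derivative Z') (at p)"
  shows "dir_deriv N Y p v = Z' v"
proof -
  have *: "((Y \<circ> \<gamma>) has_vector_derivative Z' v) (at 0)" if "curve_at N p v \<gamma>" for \<gamma>
  proof -
    have \<gamma>: "range \<gamma> \<subseteq> N" "\<gamma> 0 = p" "(\<gamma> has_vector_derivative v) (at 0)"
      using that by (auto simp: curve_at_def)
    have "((Z \<circ> \<gamma>) has_derivative (Z' \<circ> (\<lambda>t. t *\<^sub>R v))) (at 0)"
      by (rule diff_chain_at) (use \<gamma> Z in \<open>auto simp: has_vector_derivative_def\<close>)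
    moreover have "Z' \<circ> (\<lambda>t. t *\<^sub>R v) = (\<lambda>t. t *\<^sub>R Z' v)"
      using has_derivative_linear[OF Z] by (auto simp: linear_scale)
    moreover have "Y \<circ> \<gamma> = Z \<circ> \<gamma>" using \<gamma>(1) ext by (auto simp: fun_eq_iff)
    ultimately show ?thesis by (simp add: has_vector_derivative_def)
  qed
  obtain \<gamma> where "curve_at N p v \<gamma>" using v by (auto simp: tangent_space_def)
  then show ?thesis
    unfolding dir_deriv_def using * vector_derivative_unique_at
    by (intro the_equality) blast+
qed

text \<open>The unit sphere has constant curvature 1. For tangent fields \<open>V\<close> and the field \<open>E z\<close> of tangential
  parts of a constant vector \<open>z\<close>, the covariant derivative of \<open>E z\<close> along \<open>V\<close> is \<open>- (z \<bullet> q) V\<close>, so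
  all iterated derivatives are explicit.\<close>

lemma curvature_sphere:
  fixes p :: "'e::real_inner"
  assumes p: "norm p = 1" and t: "x \<bullet> p = 0" "y \<bullet> p = 0" "z \<bullet> p = 0"
  shows "curvature (sphere 0 1) p x y z = (y \<bullet> z) *\<^sub>R x - (x \<bullet> z) *\<^sub>R y"
proof -
  let ?N = "sphere 0 1 :: 'e set"
  define E where "E x q = x - (x \<bullet> q) *\<^sub>R q" for x q :: 'e
  define F where "F x q = tan_proj ?N q x" for x q :: 'e
  have FE: "F x q = E x q" if "q \<in> ?N" for x q
    using that by (simp add: F_def E_def tan_proj_sphere)
  have pN: "p \<in> ?N" using p by simp
  have Ep: "E w p = w" if "w \<bullet> p = 0" for w using that by (simp add: E_def)
  have tangent: "E x q \<bullet> q = 0" if "q \<in> ?N" for x q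
    using that by (simp add: E_def inner_diff_left dot_square_norm)
  have T: "v \<in> tangent_space ?N q \<longleftrightarrow> v \<bullet> q = 0" if "q \<in> ?N" for v q
    using that tangent_space_sphere[of q] by simp
  have E': "(E x has_derivative (\<lambda>v. - ((x \<bullet> v) *\<^sub>R q + (x \<bullet> q) *\<^sub>R v))) (at q)" for x q
    unfolding E_def by (auto intro!: derivative_eq_intros)
  have D: "dir_deriv ?N (F z) q v = - ((z \<bullet> v) *\<^sub>R q + (z \<bullet> q) *\<^sub>R v)"
    if "q \<in> ?N" "v \<bullet> q = 0" for z q v
    using dir_deriv_eq[of v ?N q "F z" "E z", OF _ FE E'] T that by simp
  have conn: "conn ?N V (F z) q = - (z \<bullet> q) *\<^sub>R V q" if "q \<in> ?N" "V q \<bullet> q = 0" for V z q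
    using that by (simp add: conn_def D tan_proj_sphere dot_square_norm inner_add_left inner_commute[of q]
        algebra_simps)
  have conn2: "conn ?N (F x) (conn ?N (F y) (F z)) p = - (z \<bullet> x) *\<^sub>R y"
    if t: "x \<bullet> p = 0" "y \<bullet> p = 0" "z \<bullet> p = 0" for x y z
  proof -
    have "dir_deriv ?N (conn ?N (F y) (F z)) p (F x p) = - (z \<bullet> F x p) *\<^sub>R E y p
        + - (z \<bullet> p) *\<^sub>R - ((y \<bullet> F x p) *\<^sub>R p + (y \<bullet> p) *\<^sub>R F x p)"
    proof (rule dir_deriv_eq)
      show "F x p \<in> tangent_space ?N p" using T[OF pN] FE[OF pN] tangent[OF pN] by simp
      show "conn ?N (F y) (F z) q = - (z \<bullet> q) *\<^sub>R E y q" if "q \<in> ?N" for q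
        using conn[OF that, of "F y"] FE[OF that] tangent[OF that] by simp
      show "((\<lambda>q. - (z \<bullet> q) *\<^sub>R E y q) has_derivative
          (\<lambda>v. - (z \<bullet> v) *\<^sub>R E y p + - (z \<bullet> p) *\<^sub>R - ((y \<bullet> v) *\<^sub>R p + (y \<bullet> p) *\<^sub>R v))) (at p)"
        by (rule derivative_eq_intros E' refl | simp add: add.commute)+
    qed
    then show ?thesis
      using t p FE[OF pN, of x] FE[OF pN, of y] by (simp add: conn_def Ep tan_proj_sphere)
  qed
  \<comment> \<open>The extensions chosen in the definition of the curvature commute at \<open>p\<close>.\<close>
  have lie: "lie_bracket ?N (F x) (F y) p = 0"
    using t FE[OF pN] D[OF pN] by (simp add: lie_bracket_def Ep inner_commute[of x y])
  have "conn ?N (lie_bracket ?N (F x) (F y)) (F z) p = 0"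
    using conn[OF pN, of "lie_bracket ?N (F x) (F y)"] lie by simp
  then show ?thesis
    using conn2[OF t] conn2[OF t(2,1,3)] unfolding curvature_def curv_field_def F_def[symmetric]
    by (simp add: inner_commute)
qed

section \<open>Immersed surfaces in the unit sphere\<close>

locale spherical_surface =
  fixes f :: "real ^ 2 \<Rightarrow> 'e::euclidean_space" and U :: "(real ^ 2) set"
  assumes U: "open U" and smooth: "smooth_on f U"
    and on_sphere: "\<And>u. u \<in> U \<Longrightarrow> f u \<in> sphere 0 1"
    and immersion: "\<And>u. u \<in> U \<Longrightarrow> inj (frechet_derivative f (at u))"
begin

abbreviation frame :: "real ^ 2 \<Rightarrow> real ^ 2 \<Rightarrow> real ^ 2 \<Rightarrow> bool" where
  "frame u \<equiv> ortho_frame (\<lambda>v. vderiv v f u)"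

abbreviation H :: "real ^ 2 \<Rightarrow> 'e" where
  "H \<equiv> mean_curvature (sphere 0 1) f"

lemmas diff = smooth_on_differentiable[OF smooth]
lemmas diff1 = smooth_on_differentiable[OF smooth_on_vderiv[OF smooth]]

lemma linear_df: "u \<in> U \<Longrightarrow> linear (\<lambda>v. vderiv v f u)"
  by (rule linear_vderiv) (rule diff)

lemma inj_df: "u \<in> U \<Longrightarrow> inj (\<lambda>v. vderiv v f u)"
  using immersion by (simp add: vderiv_def)

lemma frame_exists: "u \<in> U \<Longrightarrow> \<exists>X Y. frame u X Y"
  by (intro ortho_frame_exists linear_df inj_df)

lemma f_unit: "u \<in> U \<Longrightarrow> f u \<bullet> f u = 1" and norm_f: "u \<in> U \<Longrightarrow> norm (f u) = 1"
  using on_sphere by (auto simp: dot_square_norm)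

lemma df_perp_f:
  assumes u: "u \<in> U" shows "vderiv v f u \<bullet> f u = 0"
proof -
  have "vderiv v (\<lambda>x. f x \<bullet> f x) u = vderiv v (\<lambda>x. 1) u"
    by (rule vderiv_cong_open[OF U u]) (simp add: f_unit)
  then show ?thesis unfolding vderiv_inner[OF diff[OF u] diff[OF u]] vderiv_const
    by (simp add: inner_commute[of "f u"])
qed

lemma ddf_inner_f: "u \<in> U \<Longrightarrow> vderiv v (vderiv w f) u \<bullet> f u = - (vderiv v f u \<bullet> vderiv w f u)"
  using vderiv_orth[OF U _ df_perp_f diff1 diff, of u v w] by (simp add: inner_commute[of "vderiv w f u"])

lemma tan_proj_f: "u \<in> U \<Longrightarrow> tan_proj (sphere 0 1) (f u) w = w - (w \<bullet> f u) *\<^sub>R f u"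
  by (rule tan_proj_sphere) (rule norm_f)

lemma cov_deriv_f:
  "u \<in> U \<Longrightarrow> cov_deriv (sphere 0 1) f i V u = partial_deriv i V u - (partial_deriv i V u \<bullet> f u) *\<^sub>R f u"
  by (simp only: cov_deriv_def tan_proj_f)

lemma induced_metric_eq:
  "induced_metric f u = (\<chi> i j. vderiv (axis i 1) f u \<bullet> vderiv (axis j 1) f u)"
  by (simp add: induced_metric_def partial_deriv_eq_vderiv)

lemma metric_trace_eq:
  assumes "u \<in> U" "frame u X Y" "\<And>v. linear (b v)" "\<And>w. linear (\<lambda>v. b v w)"
  shows "metric_trace (induced_metric f u) (\<lambda>i j. b (axis i 1) (axis j 1)) = b X X + b Y Y"
  unfolding induced_metric_eq by (rule metric_trace_frame[OF linear_df[OF assms(1)] assms(2-4)])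

text \<open>The contraction with the inverse metric that gives the coordinates of the tangential part of \<open>w\<close>,
  composed with a linear map \<open>V\<close>. For \<open>V = df\<close> the value is the tangential part itself.\<close>

lemma metric_raise:
  assumes u: "u \<in> U" and XY: "frame u X Y" and V: "linear V"
  shows "(\<Sum>k\<in>UNIV. \<Sum>l\<in>UNIV. (matrix_inv (induced_metric f u) $ k $ l * (w \<bullet> vderiv (axis l 1) f u)) *\<^sub>R V (axis k 1))
    = (w \<bullet> vderiv X f u) *\<^sub>R V X + (w \<bullet> vderiv Y f u) *\<^sub>R V Y"
proof -
  have "linear (\<lambda>l. (w \<bullet> vderiv l f u) *\<^sub>R V k)" "linear (\<lambda>k. (w \<bullet> vderiv l f u) *\<^sub>R V k)" for k l
    using linear_df[OF u] V by (auto simp: linear_iff inner_add_right scaleR_add_left scaleR_add_right)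
  from metric_trace_eq[OF u XY, of "\<lambda>k l. (w \<bullet> vderiv l f u) *\<^sub>R V k", OF this]
  show ?thesis unfolding metric_trace_def scaleR_scaleR .
qed

lemma normal_part_frame:
  assumes u: "u \<in> U" and XY: "frame u X Y"
  shows "normal_part f u w = w - (w \<bullet> vderiv X f u) *\<^sub>R vderiv X f u - (w \<bullet> vderiv Y f u) *\<^sub>R vderiv Y f u"
  unfolding normal_part_def partial_deriv_eq_vderiv orth_proj_frame[OF linear_df[OF u] XY]
  by simp

lemma linear_normal_part: "u \<in> U \<Longrightarrow> linear (normal_part f u)"
proof -
  assume u: "u \<in> U"
  then obtain X Y where "frame u X Y" using frame_exists by blast
  show ?thesis
    unfolding linear_iff normal_part_frame[OF u \<open>frame u X Y\<close>]
    by (simp add: inner_add_left scaleR_add_left scaleR_diff_right)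
qed

lemma normal_part_orth:
  assumes u: "u \<in> U" shows "normal_part f u w \<bullet> vderiv v f u = 0"
proof -
  obtain X Y where XY: "frame u X Y" using frame_exists[OF u] by blast
  have 0: "normal_part f u w \<bullet> vderiv X f u = 0" "normal_part f u w \<bullet> vderiv Y f u = 0"
    using XY unfolding normal_part_frame[OF u XY] ortho_frame_def
    by (simp_all add: inner_diff_left inner_commute[of "vderiv Y f u" "vderiv X f u"])
  have "vderiv v f u \<in> range (\<lambda>v. vderiv v f u)" by blast
  then obtain a b where "vderiv v f u = a *\<^sub>R vderiv X f u + b *\<^sub>R vderiv Y f u"
    unfolding ortho_frame_span(2)[OF linear_df[OF u] XY] by blast
  then show ?thesis using 0 by (simp add: inner_add_right)
qed

lemma normal_part_id:
  assumes u: "u \<in> U" and w: "\<And>v. w \<bullet> vderiv v f u = 0" shows "normal_part f u w = w"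
proof -
  obtain X Y where XY: "frame u X Y" using frame_exists[OF u] by blast
  show ?thesis unfolding normal_part_frame[OF u XY] w by simp
qed

lemma normal_part_f: "u \<in> U \<Longrightarrow> normal_part f u (f u) = f u"
  using df_perp_f by (intro normal_part_id) (simp_all add: inner_commute)

lemma normal_part_inner_f:
  assumes u: "u \<in> U" shows "normal_part f u w \<bullet> f u = w \<bullet> f u"
proof -
  obtain X Y where XY: "frame u X Y" using frame_exists[OF u] by blast
  show ?thesis unfolding normal_part_frame[OF u XY] by (simp add: inner_diff_left df_perp_f[OF u])
qed

lemma normal_part_df:
  assumes u: "u \<in> U" shows "normal_part f u (vderiv v f u) = 0"
proof -
  obtain X Y where XY: "frame u X Y" using frame_exists[OF u] by blast
  have "vderiv v f u = (vderiv v f u \<bullet> vderiv X f u) *\<^sub>R vderiv X f u + (vderiv v f u \<bullet> vderiv Y f u) *\<^sub>R vderiv Y f u"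
    using arg_cong[OF ortho_frame_expand[OF linear_df[OF u] XY, of v], of "\<lambda>v. vderiv v f u"]
    by (simp only: linear_add[OF linear_df[OF u]] linear_scale[OF linear_df[OF u]])
  then show ?thesis
    unfolding normal_part_frame[OF u XY] by (simp only: diff_diff_eq right_minus_eq)
qed

text \<open>The second fundamental form in the unit sphere, as a bilinear form on the parameter plane. The
  component of the flat second derivative along the position vector is \<open>- df v \<bullet> df w\<close>; the last
  summand removes it.\<close>

definition II :: "real ^ 2 \<Rightarrow> real ^ 2 \<Rightarrow> real ^ 2 \<Rightarrow> 'e" where
  "II u v w = normal_part f u (vderiv v (vderiv w f) u) + (vderiv v f u \<bullet> vderiv w f u) *\<^sub>R f u"

lemma linear_II:
  assumes u: "u \<in> U" shows "linear (II u v)" "linear (\<lambda>v. II u v w)"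
  unfolding II_def[abs_def] using linear_vderiv_vderiv[OF U smooth u] linear_df[OF u] linear_normal_part[OF u]
  by (auto simp: linear_iff inner_add_left inner_add_right scaleR_add_left scaleR_add_right)

lemma second_fundamental_form_eq:
  assumes u: "u \<in> U"
  shows "second_fundamental_form (sphere 0 1) f i j u = II u (axis i 1) (axis j 1)"
  unfolding second_fundamental_form_def cov_deriv_f[OF u] II_def partial_deriv_eq_vderiv ddf_inner_f[OF u]
  by (simp add: linear_add[OF linear_normal_part[OF u]] linear_scale[OF linear_normal_part[OF u]] normal_part_f[OF u])

lemma mean_curvature_frame:
  assumes u: "u \<in> U" and XY: "frame u X Y"
  shows "H u = (1/2) *\<^sub>R (II u X X + II u Y Y)"
  unfolding mean_curvature_def second_fundamental_form_eq[OF u]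
  using metric_trace_eq[OF u XY linear_II[OF u]] by simp

lemma II_inner:
  assumes u: "u \<in> U" shows "II u v w \<bullet> f u = 0" "II u v w \<bullet> vderiv x f u = 0"
  using normal_part_orth[OF u] df_perp_f[OF u] f_unit[OF u]
  by (simp_all add: II_def inner_add_left normal_part_inner_f[OF u] ddf_inner_f[OF u] inner_commute[of "f u" "vderiv x f u"])

lemma H_perp_f: "u \<in> U \<Longrightarrow> H u \<bullet> f u = 0" and H_perp_df: "u \<in> U \<Longrightarrow> H u \<bullet> vderiv v f u = 0"
proof -
  assume u: "u \<in> U"
  then obtain X Y where XY: "frame u X Y" using frame_exists by blast
  show "H u \<bullet> f u = 0" "H u \<bullet> vderiv v f u = 0"
    unfolding mean_curvature_frame[OF u XY] by (simp_all add: inner_add_left II_inner[OF u])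
qed

lemma normal_part_H: "u \<in> U \<Longrightarrow> normal_part f u (H u) = H u"
  by (rule normal_part_id) (simp_all add: H_perp_df)

text \<open>The Christoffel symbols of the induced metric are the coordinates of the tangential part of the
  second derivatives of \<open>f\<close>. They occur together with \<open>df\<close> in the tension field and together with the
  derivative of the tension field in the Laplacian, hence the arbitrary linear map \<open>V\<close>.\<close>

lemma christoffel_sum:
  assumes u: "u \<in> U" and XY: "frame u X Y" and V: "linear V"
  shows "(\<Sum>k\<in>UNIV. christoffel (induced_metric f) k i j u *\<^sub>R V (axis k 1))
    = (vderiv (axis i 1) (vderiv (axis j 1) f) u \<bullet> vderiv X f u) *\<^sub>R V X
    + (vderiv (axis i 1) (vderiv (axis j 1) f) u \<bullet> vderiv Y f u) *\<^sub>R V Y"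
proof -
  let ?d = "\<lambda>i. vderiv (axis i 1)"
  have dG: "partial_deriv i (\<lambda>v. induced_metric f v $ j $ l) u
      = ?d j f u \<bullet> ?d i (?d l f) u + ?d i (?d j f) u \<bullet> ?d l f u" for i j l
    unfolding induced_metric_eq partial_deriv_eq_vderiv
    using vderiv_inner[OF diff1[OF u] diff1[OF u]] by simp
  have comm: "?d i (?d j f) u = ?d j (?d i f) u" for i j
    by (rule vderiv_commute[OF U smooth u])
  have "christoffel (induced_metric f) k i j u
      = (\<Sum>l\<in>UNIV. matrix_inv (induced_metric f u) $ k $ l * (?d i (?d j f) u \<bullet> ?d l f u))" for k
  proof -
    have "partial_deriv i (\<lambda>v. induced_metric f v $ j $ l) u + partial_deriv j (\<lambda>v. induced_metric f v $ i $ l) u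
        - partial_deriv l (\<lambda>v. induced_metric f v $ i $ j) u = 2 * (?d i (?d j f) u \<bullet> ?d l f u)" for l
      unfolding dG comm[of l i] comm[of l j] comm[of j i]
      using inner_commute[of "?d i f u" "?d j (?d l f) u"] inner_commute[of "?d j f u" "?d i (?d l f) u"] by simp
    then show ?thesis unfolding christoffel_def by (simp add: sum_divide_distrib)
  qed
  then show ?thesis
    using metric_raise[OF u XY V, of "?d i (?d j f) u"] by (simp add: scaleR_sum_left)
qed

text \<open>For the induced metric the tangential part of the second derivative cancels against the
  Christoffel terms, so the Hessian of an isometric immersion is its second fundamental form.\<close>

lemma tension_eq:
  assumes u: "u \<in> U" shows "tension (sphere 0 1) (induced_metric f) f u = 2 *\<^sub>R H u"
proof -
  obtain X Y where XY: "frame u X Y" using frame_exists[OF u] by blast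
  have "hessian_map (sphere 0 1) (induced_metric f) f i j u = II u (axis i 1) (axis j 1)" for i j
    using christoffel_sum[OF u XY linear_df[OF u], of i j]
    by (simp add: hessian_map_def partial_deriv_eq_vderiv cov_deriv_f[OF u] II_def ddf_inner_f[OF u] normal_part_frame[OF u XY])
  then show ?thesis
    unfolding tension_def mean_curvature_frame[OF u XY]
    using metric_trace_eq[OF u XY linear_II[OF u]] by simp
qed

lemma smooth_df: "smooth_on (vderiv v f) U"
  using smooth by blast

lemma smooth_matrix_inv: "smooth_on (\<lambda>u. matrix_inv (induced_metric f u) $ i $ j) U"
proof -
  have det: "det (induced_metric f u) \<noteq> 0" if u: "u \<in> U" for u
  proof -
    obtain X Y where XY: "frame u X Y" using frame_exists[OF u] by blast
    from frame_matrix_inverse[OF linear_df[OF u] XY]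
    have "det ((\<chi> i j. X $ i * X $ j + Y $ i * Y $ j)) * det (induced_metric f u) = 1"
      unfolding induced_metric_eq det_mul[symmetric] by simp
    then show ?thesis by auto
  qed
  have G: "smooth_on (\<lambda>u. induced_metric f u $ i $ j) U" for i j
    unfolding induced_metric_eq using smooth_on_inner[OF U smooth_df smooth_df] by simp
  have D: "smooth_on (\<lambda>u. inverse (det (induced_metric f u))) U"
  proof (rule smooth_on_inverse[OF U _ det])
    show "smooth_on (\<lambda>u. det (induced_metric f u)) U"
      unfolding det_2 by (intro smooth_on_diff[OF U] smooth_on_mult[OF U] G)
  qed
  have "smooth_on (\<lambda>u. (if i = j then induced_metric f u $ (3 - i) $ (3 - i) else - induced_metric f u $ i $ j)
      * inverse (det (induced_metric f u))) U"
    by (cases "i = j"; simp only: if_True if_False refl; intro smooth_on_mult[OF U _ D] G smooth_on_minus[OF U])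
  then show ?thesis
    by (subst smooth_on_cong[OF U]) (auto simp: matrix_inv_2 det)
qed

text \<open>The mean curvature vector is written as a rational expression in derivatives of \<open>f\<close> and entries of
  the inverse metric; the expression through frames would not show smoothness.\<close>

lemma smooth_H: "smooth_on H U"
proof -
  let ?g = "\<lambda>u k l. matrix_inv (induced_metric f u) $ k $ l"
  let ?d = "\<lambda>i::2. vderiv (axis i 1 :: real ^ 2)"
  define T where "T i j u = (\<Sum>k\<in>UNIV. \<Sum>l\<in>UNIV. (?g u k l * (?d i (?d j f) u \<bullet> ?d l f u)) *\<^sub>R ?d k f u)" for i j u
  define B where "B i j u = ?d i (?d j f) u - T i j u + (?d i f u \<bullet> ?d j f u) *\<^sub>R f u" for i j u
  have smT: "smooth_on (T i j) U" for i j
    unfolding T_def[abs_def] sum_2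
    by (intro smooth_on_add[OF U] smooth_on_scaleR[OF U] smooth_on_mult[OF U] smooth_on_inner[OF U]
        smooth_matrix_inv smooth_df smooth_on_vderiv)
  have sm: "smooth_on (B i j) U" for i j
    unfolding B_def[abs_def]
    by (intro smooth_on_add[OF U] smooth_on_diff[OF U] smooth_on_scaleR[OF U] smooth_on_inner[OF U]
        smT smooth_df smooth_on_vderiv smooth)
  have eq: "H u = (1/2) *\<^sub>R (\<Sum>i\<in>UNIV. \<Sum>j\<in>UNIV. ?g u i j *\<^sub>R B i j u)" if u: "u \<in> U" for u
  proof -
    obtain X Y where XY: "frame u X Y" using frame_exists[OF u] by blast
    have "II u (axis i 1) (axis j 1) = B i j u" for i j
      using metric_raise[OF u XY linear_df[OF u], of "?d i (?d j f) u"]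
      by (simp add: II_def B_def T_def normal_part_frame[OF u XY])
    then show ?thesis unfolding mean_curvature_def second_fundamental_form_eq[OF u] metric_trace_def by simp
  qed
  have "smooth_on (\<lambda>u. (1/2) *\<^sub>R (\<Sum>i\<in>UNIV. \<Sum>j\<in>UNIV. ?g u i j *\<^sub>R B i j u)) U"
    unfolding sum_2
    by (intro smooth_on_add[OF U] smooth_on_scaleR[OF U] smooth_matrix_inv sm smooth_on_const)
  moreover have "smooth_on H U \<longleftrightarrow> smooth_on (\<lambda>u. (1/2) *\<^sub>R (\<Sum>i\<in>UNIV. \<Sum>j\<in>UNIV. ?g u i j *\<^sub>R B i j u)) U"
    by (rule smooth_on_cong[OF U]) (rule eq)
  ultimately show ?thesis by blast
qed

end

section \<open>Biharmonic surfaces with parallel mean curvature\<close>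

locale biharmonic_pmc_surface = spherical_surface f U
  for f :: "real ^ 2 \<Rightarrow> 'e::euclidean_space" and U +
  assumes pmc: "\<And>u i. u \<in> U \<Longrightarrow> normal_conn (sphere 0 1) f i H u = 0"
    and biharmonic: "\<And>u. u \<in> U \<Longrightarrow> bitension (sphere 0 1) (induced_metric f) f u = 0"
begin

lemmas diffH = smooth_on_differentiable[OF smooth_H]
lemmas diffH1 = smooth_on_differentiable[OF smooth_on_vderiv[OF smooth_H]]

lemma linear_dH: "u \<in> U \<Longrightarrow> linear (\<lambda>v. vderiv v H u)"
  by (rule linear_vderiv) (rule diffH)

lemma dH_perp_f: "u \<in> U \<Longrightarrow> vderiv v H u \<bullet> f u = 0"
  using vderiv_orth[OF U _ H_perp_f diffH diff, of u v] H_perp_df by simp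

lemma normal_part_dH_axis: "u \<in> U \<Longrightarrow> normal_part f u (vderiv (axis i 1) H u) = 0"
  using pmc[of u i] dH_perp_f[of u "axis i 1"] by (simp add: normal_conn_def cov_deriv_f partial_deriv_eq_vderiv)

text \<open>Parallel mean curvature says that \<open>dH\<close> has no component normal to the surface within the sphere. It
  has none along the position vector either, by \<open>dH_perp_f\<close>. So \<open>dH\<close> is tangent to the surface.\<close>

lemma dH_frame:
  assumes u: "u \<in> U" and XY: "frame u X Y"
  shows "vderiv v H u = (vderiv v H u \<bullet> vderiv X f u) *\<^sub>R vderiv X f u + (vderiv v H u \<bullet> vderiv Y f u) *\<^sub>R vderiv Y f u"
proof -
  have "vderiv v H u = v $ 1 *\<^sub>R vderiv (axis 1 1) H u + v $ 2 *\<^sub>R vderiv (axis 2 1) H u"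
    by (subst vec2_expand[of v]) (simp only: linear_add[OF linear_dH[OF u]] linear_scale[OF linear_dH[OF u]])
  then have "normal_part f u (vderiv v H u) = 0"
    by (simp add: linear_add[OF linear_normal_part[OF u]] linear_scale[OF linear_normal_part[OF u]] normal_part_dH_axis[OF u])
  then show ?thesis unfolding normal_part_frame[OF u XY] by (simp add: algebra_simps)
qed

lemma dH_inner_df: "u \<in> U \<Longrightarrow> vderiv v H u \<bullet> vderiv w f u = - (H u \<bullet> vderiv v (vderiv w f) u)"
  by (rule vderiv_orth[OF U _ H_perp_df diffH diff1])

text \<open>The operator \<open>A\<close> with \<open>dH = - df \<circ> A\<close> is self-adjoint: pairing \<open>dH v\<close> with \<open>df w\<close> gives minus the
  component of the symmetric second derivative of \<open>f\<close> along \<open>H\<close>.\<close>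

lemma dH_sym: "u \<in> U \<Longrightarrow> vderiv v H u \<bullet> vderiv w f u = vderiv w H u \<bullet> vderiv v f u"
  unfolding dH_inner_df using vderiv_commute[OF U smooth] by simp

lemma dH_perp_H:
  assumes u: "u \<in> U" shows "vderiv v H u \<bullet> H u = 0"
proof -
  obtain X Y where XY: "frame u X Y" using frame_exists[OF u] by blast
  show ?thesis by (subst dH_frame[OF u XY]) (simp add: inner_add_left inner_add_right H_perp_df[OF u] inner_commute[of _ "H u"])
qed

lemma ddH_inner_H: "u \<in> U \<Longrightarrow> vderiv v (vderiv w H) u \<bullet> H u = - (vderiv w H u \<bullet> vderiv v H u)"
  by (rule vderiv_orth[OF U _ dH_perp_H diffH1 diffH])

lemma ddH_inner_f: "u \<in> U \<Longrightarrow> vderiv v (vderiv w H) u \<bullet> f u = - (vderiv w H u \<bullet> vderiv v f u)"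
  by (rule vderiv_orth[OF U _ dH_perp_f diffH1 diff])

text \<open>The biharmonic equation in terms of flat derivatives. Since \<open>dH\<close> is tangent to the sphere,
  covariant derivatives of \<open>H\<close> differ from flat ones only in the component of the second derivatives
  along \<open>f\<close>. Since the tension field is normal to the surface, the curvature term is a multiple of \<open>H\<close>.\<close>

lemma biharmonic_frame:
  assumes u: "u \<in> U" and XY: "frame u X Y"
  defines "t \<equiv> vderiv X (vderiv X f) u + vderiv Y (vderiv Y f) u"
  shows "vderiv X (vderiv X H) u + vderiv Y (vderiv Y H) u
      + (vderiv X H u \<bullet> vderiv X f u + vderiv Y H u \<bullet> vderiv Y f u) *\<^sub>R f u + 2 *\<^sub>R H u
    = (t \<bullet> vderiv X f u) *\<^sub>R vderiv X H u + (t \<bullet> vderiv Y f u) *\<^sub>R vderiv Y H u"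
proof -
  let ?N = "sphere 0 1 :: 'e set"
  let ?\<tau> = "tension ?N (induced_metric f) f"
  let ?d = "\<lambda>i::2. vderiv (axis i 1 :: real ^ 2)"
  have d\<tau>: "vderiv v ?\<tau> x = 2 *\<^sub>R vderiv v H x" if "x \<in> U" for x v
    using vderiv_cong_open[OF U that tension_eq] vderiv_scaleR_const[OF diffH[OF that]] by simp
  have cov: "cov_deriv ?N f j ?\<tau> x = 2 *\<^sub>R ?d j H x" if "x \<in> U" for x j
    using that by (simp add: cov_deriv_f partial_deriv_eq_vderiv d\<tau> dH_perp_f)
  have dcov: "vderiv v (cov_deriv ?N f j ?\<tau>) u = 2 *\<^sub>R vderiv v (?d j H) u" for v j
    using vderiv_cong_open[OF U u cov] vderiv_scaleR_const[OF diffH1[OF u]] by simp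
  define b where "b v w = 2 *\<^sub>R (vderiv v (vderiv w H) u - (vderiv v (vderiv w H) u \<bullet> f u) *\<^sub>R f u
      - ((vderiv v (vderiv w f) u \<bullet> vderiv X f u) *\<^sub>R vderiv X H u
        + (vderiv v (vderiv w f) u \<bullet> vderiv Y f u) *\<^sub>R vderiv Y H u))" for v w
  have b: "linear (b v)" "linear (\<lambda>v. b v w)" for v w
    unfolding b_def[abs_def]
    using linear_vderiv_vderiv[OF U smooth u] linear_vderiv_vderiv[OF U smooth_H u]
    by (auto simp: linear_iff inner_add_left scaleR_add_left scaleR_add_right scaleR_diff_right mult_ac)
  have lap: "rough_laplacian ?N (induced_metric f) f ?\<tau> u = - (b X X + b Y Y)"
  proof -
    have "cov_deriv ?N f i (cov_deriv ?N f j ?\<tau>) u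
        - (\<Sum>k\<in>UNIV. christoffel (induced_metric f) k i j u *\<^sub>R cov_deriv ?N f k ?\<tau> u) = b (axis i 1) (axis j 1)" for i j
    proof -
      have lin: "linear (\<lambda>v. 2 *\<^sub>R vderiv v H u)"
        using linear_dH[OF u] by (auto simp: linear_iff scaleR_add_right)
      show ?thesis
        unfolding cov[OF u] unfolding christoffel_sum[OF u XY lin] cov_deriv_f[OF u] partial_deriv_eq_vderiv dcov b_def
        by (simp add: scaleR_diff_right scaleR_add_right mult.commute)
    qed
    then show ?thesis unfolding rough_laplacian_def using metric_trace_eq[OF u XY b] by simp
  qed
  define c where "c v w = - (vderiv v f u \<bullet> vderiv w f u) *\<^sub>R (2 *\<^sub>R H u)" for v w
  have c: "linear (c v)" "linear (\<lambda>v. c v w)" for v w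
    unfolding c_def[abs_def] using linear_df[OF u]
    by (auto simp: linear_iff inner_add_left inner_add_right scaleR_add_left scaleR_diff_left)
  have R: "curvature ?N (f u) (partial_deriv i f u) (?\<tau> u) (partial_deriv j f u) = c (axis i 1) (axis j 1)" for i j
    unfolding tension_eq[OF u] partial_deriv_eq_vderiv
    using curvature_sphere[OF norm_f[OF u], of "?d i f u" "2 *\<^sub>R H u" "?d j f u"] df_perp_f[OF u] H_perp_f[OF u] H_perp_df[OF u]
    by (simp add: c_def)
  have curv: "metric_trace (induced_metric f u) (\<lambda>i j. curvature ?N (f u) (partial_deriv i f u) (?\<tau> u) (partial_deriv j f u))
      = - (4 *\<^sub>R H u)"
  proof -
    have "4 *\<^sub>R H u = 2 *\<^sub>R H u + 2 *\<^sub>R H u" by (simp add: scaleR_add_left[symmetric])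
    then show ?thesis
      using metric_trace_eq[OF u XY c] XY unfolding R by (simp add: c_def ortho_frame_def)
  qed
  have "b X X + b Y Y + 4 *\<^sub>R H u = 0"
    using biharmonic[OF u] unfolding bitension_def lap curv by (simp add: add.commute)
  then have "2 *\<^sub>R (vderiv X (vderiv X H) u + vderiv Y (vderiv Y H) u
      + (vderiv X H u \<bullet> vderiv X f u + vderiv Y H u \<bullet> vderiv Y f u) *\<^sub>R f u + 2 *\<^sub>R H u
      - ((t \<bullet> vderiv X f u) *\<^sub>R vderiv X H u + (t \<bullet> vderiv Y f u) *\<^sub>R vderiv Y H u)) = 0"
    unfolding b_def ddH_inner_f[OF u] t_def by (simp add: inner_add_left algebra_simps)
  then show ?thesis by simp
qed

lemma normal_part_dH:
  assumes u: "u \<in> U" shows "normal_part f u (vderiv v H u) = 0"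
proof -
  obtain X Y where XY: "frame u X Y" using frame_exists[OF u] by blast
  show ?thesis using dH_frame[OF u XY, of v] unfolding normal_part_frame[OF u XY] by (simp add: algebra_simps)
qed

lemma mean_curvature_normal:
  assumes u: "u \<in> U" and XY: "frame u X Y"
  shows "normal_part f u (vderiv X (vderiv X f) u) + normal_part f u (vderiv Y (vderiv Y f) u)
    = 2 *\<^sub>R H u - 2 *\<^sub>R f u"
  using mean_curvature_frame[OF u XY] XY by (simp add: II_def ortho_frame_def scaleR_2 algebra_simps)

text \<open>The inner product of the formula for the mean curvature vector with \<open>H\<close>: the trace of \<open>A\<close> is
  \<open>2 |H|\<^sup>2\<close>.\<close>

lemma trace_dH:
  assumes u: "u \<in> U" and XY: "frame u X Y"
  shows "vderiv X H u \<bullet> vderiv X f u + vderiv Y H u \<bullet> vderiv Y f u = - 2 * (H u \<bullet> H u)"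
proof -
  have "H u \<bullet> normal_part f u w = H u \<bullet> w" for w
    unfolding normal_part_frame[OF u XY] by (simp add: inner_diff_right H_perp_df[OF u])
  then have "H u \<bullet> vderiv X (vderiv X f) u + H u \<bullet> vderiv Y (vderiv Y f) u = H u \<bullet> (2 *\<^sub>R H u - 2 *\<^sub>R f u)"
    unfolding mean_curvature_normal[OF u XY, symmetric] by (simp add: inner_add_right)
  then show ?thesis unfolding dH_inner_df[OF u] by (simp add: inner_diff_right H_perp_f[OF u])
qed

lemma biharmonic_normal:
  assumes u: "u \<in> U" and XY: "frame u X Y"
  shows "normal_part f u (vderiv X (vderiv X H) u) + normal_part f u (vderiv Y (vderiv Y H) u)
    = (2 * (H u \<bullet> H u)) *\<^sub>R f u - 2 *\<^sub>R H u"
proof -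
  note lin = linear_normal_part[OF u]
  show ?thesis
    using arg_cong[OF biharmonic_frame[OF u XY], of "normal_part f u"] trace_dH[OF u XY]
    by (simp add: linear_add[OF lin] linear_diff[OF lin] linear_scale[OF lin] normal_part_H[OF u] normal_part_f[OF u] normal_part_dH[OF u] algebra_simps)
qed

text \<open>The inner product of the biharmonic equation with \<open>H\<close>. As \<open>dH\<close> is orthogonal to \<open>H\<close>, second
  derivatives of \<open>H\<close> pair with \<open>H\<close> to minus the squared length of \<open>dH\<close>; so the trace of \<open>A\<^sup>2\<close> is also
  \<open>2 |H|\<^sup>2\<close>.\<close>

lemma norm_dH:
  assumes u: "u \<in> U" and XY: "frame u X Y"
  shows "vderiv X H u \<bullet> vderiv X H u + vderiv Y H u \<bullet> vderiv Y H u = 2 * (H u \<bullet> H u)"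
proof -
  have "normal_part f u w \<bullet> H u = w \<bullet> H u" for w
    unfolding normal_part_frame[OF u XY] by (simp add: inner_diff_left inner_diff_right inner_commute[of _ "H u"] H_perp_df[OF u])
  then show ?thesis
    using arg_cong[OF biharmonic_normal[OF u XY], of "\<lambda>w. w \<bullet> H u"] H_perp_f[OF u]
    by (simp add: inner_add_left inner_diff_left ddH_inner_H[OF u] inner_commute[of "f u" "H u"])
qed

text \<open>The Cayley-Hamilton theorem for \<open>A\<close>, expressed by inner products. From \<open>trace A = 2k\<close> and
  \<open>trace A\<^sup>2 = 2k\<close> the determinant of \<open>A\<close> is \<open>2k\<^sup>2 - k\<close>, so \<open>A\<^sup>2 - 2k A + (2k\<^sup>2 - k) = 0\<close>. The mixed
  term has the opposite sign because \<open>dH = - df \<circ> A\<close>.\<close>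

lemma third_form_relation:
  assumes u: "u \<in> U"
  defines "k \<equiv> H u \<bullet> H u"
  shows "vderiv v H u \<bullet> vderiv w H u + 2 * k * (vderiv v H u \<bullet> vderiv w f u)
    + (2 * k\<^sup>2 - k) * (vderiv v f u \<bullet> vderiv w f u) = 0"
proof -
  obtain X Y where XY: "frame u X Y" using frame_exists[OF u] by blast
  define a where "a = vderiv X H u \<bullet> vderiv X f u"
  define b where "b = vderiv X H u \<bullet> vderiv Y f u"
  define c where "c = vderiv Y H u \<bullet> vderiv Y f u"
  have b': "vderiv Y H u \<bullet> vderiv X f u = b" using dH_sym[OF u, of Y X] by (simp add: b_def)
  have HX: "vderiv X H u = a *\<^sub>R vderiv X f u + b *\<^sub>R vderiv Y f u"
    using dH_frame[OF u XY, of X] by (simp add: a_def b_def)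
  have HY: "vderiv Y H u = b *\<^sub>R vderiv X f u + c *\<^sub>R vderiv Y f u"
    using dH_frame[OF u XY, of Y] by (simp add: b' c_def)
  have fr: "vderiv X f u \<bullet> vderiv X f u = 1" "vderiv Y f u \<bullet> vderiv Y f u = 1"
    "vderiv X f u \<bullet> vderiv Y f u = 0" "vderiv Y f u \<bullet> vderiv X f u = 0"
    using XY by (simp_all add: ortho_frame_def inner_commute)
  have ac: "a + c = - 2 * k" using trace_dH[OF u XY] by (simp add: a_def c_def k_def)
  have in2: "(x *\<^sub>R vderiv X f u + y *\<^sub>R vderiv Y f u) \<bullet> (x' *\<^sub>R vderiv X f u + y' *\<^sub>R vderiv Y f u) = x * x' + y * y'"
    for x y x' y' by (simp add: inner_add_left inner_add_right fr)
  have "(a * a + b * b) + (b * b + c * c) = 2 * k"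
    using norm_dH[OF u XY] unfolding HX HY in2 k_def .
  moreover have "(a + c) * (a + c) = 4 * k\<^sup>2" unfolding ac by (simp add: power2_eq_square)
  \<comment> \<open>minus the determinant of \<open>A\<close>, from \<open>(trace A)\<^sup>2 - trace A\<^sup>2 = 2 det A\<close>\<close>
  ultimately have disc: "b * b - a * c = k - 2 * k\<^sup>2" by (simp add: algebra_simps)
  have k: "2 * k = - (a + c)" using ac by simp
  define p where "p = vderiv v f u \<bullet> vderiv X f u"
  define q where "q = vderiv v f u \<bullet> vderiv Y f u"
  define r where "r = vderiv w f u \<bullet> vderiv X f u"
  define s where "s = vderiv w f u \<bullet> vderiv Y f u"
  note lf = linear_df[OF u] and lH = linear_dH[OF u]
  have vw: "v = p *\<^sub>R X + q *\<^sub>R Y" "w = r *\<^sub>R X + s *\<^sub>R Y"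
    unfolding p_def q_def r_def s_def by (rule ortho_frame_expand[OF lf XY])+
  have fvw: "vderiv v f u = p *\<^sub>R vderiv X f u + q *\<^sub>R vderiv Y f u" "vderiv w f u = r *\<^sub>R vderiv X f u + s *\<^sub>R vderiv Y f u"
    using vw by (simp_all only: linear_add[OF lf] linear_scale[OF lf])
  have Hvw: "vderiv v H u = (p * a + q * b) *\<^sub>R vderiv X f u + (p * b + q * c) *\<^sub>R vderiv Y f u"
    "vderiv w H u = (r * a + s * b) *\<^sub>R vderiv X f u + (r * b + s * c) *\<^sub>R vderiv Y f u"
  proof -
    have "vderiv v H u = p *\<^sub>R vderiv X H u + q *\<^sub>R vderiv Y H u" "vderiv w H u = r *\<^sub>R vderiv X H u + s *\<^sub>R vderiv Y H u"
      using vw by (simp_all only: linear_add[OF lH] linear_scale[OF lH])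
    then show "vderiv v H u = (p * a + q * b) *\<^sub>R vderiv X f u + (p * b + q * c) *\<^sub>R vderiv Y f u"
      "vderiv w H u = (r * a + s * b) *\<^sub>R vderiv X f u + (r * b + s * c) *\<^sub>R vderiv Y f u"
      unfolding HX HY by (simp_all add: scaleR_add_left scaleR_add_right)
  qed
  have e: "2 * k\<^sup>2 - k = a * c - b * b" using disc by simp
  show ?thesis
    unfolding fvw Hvw in2 e unfolding k by (simp add: algebra_simps)
qed

text \<open>For \<open>k = 1\<close> the quadratic relation reads \<open>(A - 1)\<^sup>2 = 0\<close>, and \<open>A\<close> is self-adjoint.\<close>

lemma umbilic_if_norm_1:
  assumes u: "u \<in> U" and k: "H u \<bullet> H u = 1"
  shows "vderiv v H u = - vderiv v f u"
proof -
  have "(x + y) \<bullet> (x + y) = x \<bullet> x + 2 * (x \<bullet> y) + y \<bullet> y" for x y :: 'e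
    by (simp add: inner_add_left inner_add_right inner_commute[of y x])
  then have "(vderiv v H u + vderiv v f u) \<bullet> (vderiv v H u + vderiv v f u) = 0"
    using third_form_relation[OF u, of v v] unfolding k by simp
  then show ?thesis by (simp add: eq_neg_iff_add_eq_0)
qed

text \<open>The squared length \<open>2k - 2k\<^sup>2\<close> of \<open>A - k\<close> is nonnegative.\<close>

lemma norm_H_le_1:
  assumes u: "u \<in> U" shows "H u \<bullet> H u \<le> 1"
proof (cases "H u = 0")
  case False
  then have pos: "H u \<bullet> H u > 0" by simp
  obtain X Y where XY: "frame u X Y" using frame_exists[OF u] by blast
  define k where "k = H u \<bullet> H u"
  have fr: "vderiv X f u \<bullet> vderiv X f u = 1" "vderiv Y f u \<bullet> vderiv Y f u = 1"
    using XY by (auto simp: ortho_frame_def)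
  have sq: "0 \<le> vderiv v H u \<bullet> vderiv v H u + 2 * k * (vderiv v H u \<bullet> vderiv v f u) + k\<^sup>2 * (vderiv v f u \<bullet> vderiv v f u)" for v
  proof -
    have "(x + k *\<^sub>R y) \<bullet> (x + k *\<^sub>R y) = x \<bullet> x + 2 * k * (x \<bullet> y) + k\<^sup>2 * (y \<bullet> y)" for x y :: 'e
      by (simp add: inner_add_left inner_add_right inner_commute[of y x] power2_eq_square distrib_left mult.assoc)
    from this[symmetric] show ?thesis by simp
  qed
  have "0 \<le> 2 * k + 2 * k * (- 2 * k) + 2 * k\<^sup>2"
  proof -
    have "2 * k * (vderiv X H u \<bullet> vderiv X f u) + 2 * k * (vderiv Y H u \<bullet> vderiv Y f u) = 2 * k * (- 2 * k)"
      unfolding distrib_left[symmetric] trace_dH[OF u XY] k_def ..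
    then show ?thesis
      using sq[of X] sq[of Y] norm_dH[OF u XY] unfolding fr k_def[symmetric] by linarith
  qed
  then have "0 \<le> 2 * k * (1 - k)" by (simp add: power2_eq_square algebra_simps)
  then show ?thesis using pos unfolding k_def by (simp add: zero_le_mult_iff)
qed simp

end

section \<open>Distinct principal curvatures\<close>

context biharmonic_pmc_surface
begin

context
  fixes k :: real
  assumes k: "0 < k" "k < 1" and H_norm: "\<And>u. u \<in> U \<Longrightarrow> H u \<bullet> H u = k"
begin

text \<open>The eigenvalues of \<open>A\<close> are \<open>k + gap\<close> and \<open>k - gap\<close>. As \<open>dH = - df \<circ> A\<close>, the differential of \<open>P\<close> is
  \<open>df \<circ> (k + gap - A)\<close> and kills the first eigendirection; that of \<open>Q\<close> kills the second one.\<close>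

definition "gap = sqrt (k * (1 - k))"

definition "P u = H u + (k + gap) *\<^sub>R f u"
definition "Q u = H u + (k - gap) *\<^sub>R f u"

lemma gap: "gap > 0" "gap * gap = k * (1 - k)"
  using k by (simp_all add: gap_def)

lemma smooth_PQ: "smooth_on P U" "smooth_on Q U"
  unfolding P_def[abs_def] Q_def[abs_def]
  by (intro smooth_on_add[OF U] smooth_on_scaleR[OF U] smooth_on_const smooth_H smooth)+

lemma diff_scaled: "u \<in> U \<Longrightarrow> (\<lambda>x. c *\<^sub>R f x) differentiable (at u)"
  by (rule smooth_on_differentiable[OF smooth_on_scaleR[OF U smooth_on_const smooth]])

lemma dP: "u \<in> U \<Longrightarrow> vderiv v P u = vderiv v H u + (k + gap) *\<^sub>R vderiv v f u"
  and dQ: "u \<in> U \<Longrightarrow> vderiv v Q u = vderiv v H u + (k - gap) *\<^sub>R vderiv v f u"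
  unfolding P_def[abs_def] Q_def[abs_def]
  using vderiv_add[OF diffH diff_scaled] vderiv_scaleR_const[OF diff] by simp_all

lemma ddP: "u \<in> U \<Longrightarrow> vderiv w (vderiv v P) u = vderiv w (vderiv v H) u + (k + gap) *\<^sub>R vderiv w (vderiv v f) u"
  and ddQ: "u \<in> U \<Longrightarrow> vderiv w (vderiv v Q) u = vderiv w (vderiv v H) u + (k - gap) *\<^sub>R vderiv w (vderiv v f) u"
proof -
  assume u: "u \<in> U"
  have ds: "(\<lambda>x. c *\<^sub>R vderiv v f x) differentiable (at u)" for c
    by (rule smooth_on_differentiable[OF smooth_on_scaleR[OF U smooth_on_const smooth_df] u])
  show "vderiv w (vderiv v P) u = vderiv w (vderiv v H) u + (k + gap) *\<^sub>R vderiv w (vderiv v f) u"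
  proof -
    have "vderiv w (vderiv v P) u = vderiv w (\<lambda>x. vderiv v H x + (k + gap) *\<^sub>R vderiv v f x) u"
      by (rule vderiv_cong_open[OF U u]) (rule dP)
    then show ?thesis
      unfolding vderiv_add[OF diffH1[OF u] ds] vderiv_scaleR_const[OF diff1[OF u]] .
  qed
  show "vderiv w (vderiv v Q) u = vderiv w (vderiv v H) u + (k - gap) *\<^sub>R vderiv w (vderiv v f) u"
  proof -
    have "vderiv w (vderiv v Q) u = vderiv w (\<lambda>x. vderiv v H x + (k - gap) *\<^sub>R vderiv v f x) u"
      by (rule vderiv_cong_open[OF U u]) (rule dQ)
    then show ?thesis
      unfolding vderiv_add[OF diffH1[OF u] ds] vderiv_scaleR_const[OF diff1[OF u]] .
  qed
qed

text \<open>The inner product is the quadratic relation for \<open>A\<close>, with the polynomial split into its two linear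
  factors.\<close>

lemma dP_perp_dQ:
  assumes u: "u \<in> U" shows "vderiv v P u \<bullet> vderiv w Q u = 0"
proof -
  have "vderiv v P u \<bullet> vderiv w Q u = vderiv v H u \<bullet> vderiv w H u + (k - gap) * (vderiv v H u \<bullet> vderiv w f u)
      + (k + gap) * (vderiv v f u \<bullet> vderiv w H u) + (k + gap) * (k - gap) * (vderiv v f u \<bullet> vderiv w f u)"
    unfolding dP[OF u] dQ[OF u] by (simp add: inner_add_left inner_add_right algebra_simps)
  also have "vderiv v f u \<bullet> vderiv w H u = vderiv v H u \<bullet> vderiv w f u"
    using dH_sym[OF u, of v w] by (simp add: inner_commute)
  also have "(k + gap) * (k - gap) = 2 * k\<^sup>2 - k"
    using gap(2) by (simp add: algebra_simps power2_eq_square)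
  finally show ?thesis
    using third_form_relation[OF u, of v w] unfolding H_norm[OF u] by (simp add: algebra_simps)
qed

lemma dP_frame: "u \<in> U \<Longrightarrow> frame u X Y \<Longrightarrow>
    vderiv v P u = (vderiv v P u \<bullet> vderiv X f u) *\<^sub>R vderiv X f u + (vderiv v P u \<bullet> vderiv Y f u) *\<^sub>R vderiv Y f u"
  and dQ_frame: "u \<in> U \<Longrightarrow> frame u X Y \<Longrightarrow>
    vderiv v Q u = (vderiv v Q u \<bullet> vderiv X f u) *\<^sub>R vderiv X f u + (vderiv v Q u \<bullet> vderiv Y f u) *\<^sub>R vderiv Y f u"
proof -
  assume u: "u \<in> U" and XY: "frame u X Y"
  note lin = linear_normal_part[OF u]
  have "normal_part f u (vderiv v f u) = 0" by (rule normal_part_df[OF u])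
  then have "normal_part f u (vderiv v P u) = 0" "normal_part f u (vderiv v Q u) = 0"
    unfolding dP[OF u] dQ[OF u] by (simp_all add: linear_add[OF lin] linear_scale[OF lin] normal_part_dH[OF u])
  then show "vderiv v P u = (vderiv v P u \<bullet> vderiv X f u) *\<^sub>R vderiv X f u + (vderiv v P u \<bullet> vderiv Y f u) *\<^sub>R vderiv Y f u"
    "vderiv v Q u = (vderiv v Q u \<bullet> vderiv X f u) *\<^sub>R vderiv X f u + (vderiv v Q u \<bullet> vderiv Y f u) *\<^sub>R vderiv Y f u"
    unfolding normal_part_frame[OF u XY] by (simp_all add: algebra_simps)
qed

text \<open>The eigenvectors are found as the images of the two differentials: neither \<open>dP\<close> nor \<open>dQ\<close> vanishes,
  since the trace \<open>2k\<close> of \<open>A\<close> is neither \<open>2 (k + gap)\<close> nor \<open>2 (k - gap)\<close>; and each image is spanned by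
  \<open>df v\<close> for a vector \<open>v\<close> that the other differential kills, because \<open>A\<close> is self-adjoint.\<close>

lemma principal_frame:
  assumes u: "u \<in> U"
  shows "\<exists>X Y. frame u X Y \<and> vderiv X P u = 0 \<and> vderiv Y Q u = 0"
proof -
  obtain A B where AB: "frame u A B" using frame_exists[OF u] by blast
  note lf = linear_df[OF u]
  have zero: "w = 0" if "w = (w \<bullet> vderiv A f u) *\<^sub>R vderiv A f u + (w \<bullet> vderiv B f u) *\<^sub>R vderiv B f u"
    "\<And>v. w \<bullet> vderiv v f u = 0" for w
    using that by simp
  have unit: "\<exists>X. vderiv X f u = (1 / norm w) *\<^sub>R w"
    if "w = (w \<bullet> vderiv A f u) *\<^sub>R vderiv A f u + (w \<bullet> vderiv B f u) *\<^sub>R vderiv B f u" for w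
  proof -
    have "vderiv ((1 / norm w) *\<^sub>R ((w \<bullet> vderiv A f u) *\<^sub>R A + (w \<bullet> vderiv B f u) *\<^sub>R B)) f u = (1 / norm w) *\<^sub>R w"
      using that by (simp only: linear_add[OF lf] linear_scale[OF lf])
    then show ?thesis by blast
  qed
  have norm1: "((1 / norm w) *\<^sub>R w) \<bullet> ((1 / norm w) *\<^sub>R w) = 1" if "w \<noteq> 0" for w :: 'e
    using that by (simp add: dot_square_norm power2_eq_square)
  have fr: "vderiv A f u \<bullet> vderiv A f u = 1" "vderiv B f u \<bullet> vderiv B f u = 1"
    using AB by (auto simp: ortho_frame_def)
  have tr: "(\<exists>v. vderiv v P u \<noteq> 0) \<and> (\<exists>v. vderiv v Q u \<noteq> 0)"
  proof (rule conjI; rule ccontr)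
    assume "\<not> (\<exists>v. vderiv v P u \<noteq> 0)"
    then have "vderiv v H u = - (k + gap) *\<^sub>R vderiv v f u" for v
      using dP[OF u, of v] by (simp only: scaleR_minus_left eq_neg_iff_add_eq_0) simp
    then show False using trace_dH[OF u AB] gap(1) unfolding H_norm[OF u] by (simp add: fr)
  next
    assume "\<not> (\<exists>v. vderiv v Q u \<noteq> 0)"
    then have "vderiv v H u = - (k - gap) *\<^sub>R vderiv v f u" for v
      using dQ[OF u, of v] by (simp only: scaleR_minus_left eq_neg_iff_add_eq_0) simp
    then show False using trace_dH[OF u AB] gap(1) unfolding H_norm[OF u] by (simp add: fr)
  qed
  then obtain p q where pq: "vderiv p P u \<noteq> 0" "vderiv q Q u \<noteq> 0" by blast
  obtain Y where Y: "vderiv Y f u = (1 / norm (vderiv p P u)) *\<^sub>R vderiv p P u"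
    using unit[OF dP_frame[OF u AB]] by blast
  obtain X where X: "vderiv X f u = (1 / norm (vderiv q Q u)) *\<^sub>R vderiv q Q u"
    using unit[OF dQ_frame[OF u AB]] by blast
  have "frame u X Y"
    unfolding ortho_frame_def X Y
    using norm1 pq dP_perp_dQ[OF u, of p q] by (auto simp: inner_commute)
  moreover have "vderiv X P u = 0"
  proof (rule zero[OF dP_frame[OF u AB]])
    fix w
    have "vderiv X P u \<bullet> vderiv w f u = vderiv w P u \<bullet> vderiv X f u"
      unfolding dP[OF u] using dH_sym[OF u, of X w] by (simp add: inner_add_left inner_add_right inner_commute)
    then show "vderiv X P u \<bullet> vderiv w f u = 0" unfolding X by (simp add: dP_perp_dQ[OF u])
  qed
  moreover have "vderiv Y Q u = 0"
  proof (rule zero[OF dQ_frame[OF u AB]])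
    fix w
    have "vderiv Y Q u \<bullet> vderiv w f u = vderiv Y f u \<bullet> vderiv w Q u"
      unfolding dQ[OF u] using dH_sym[OF u, of Y w] by (simp add: inner_add_left inner_add_right inner_commute)
    then show "vderiv Y Q u \<bullet> vderiv w f u = 0" unfolding Y by (simp add: dP_perp_dQ[OF u])
  qed
  ultimately show ?thesis by blast
qed

text \<open>The differentials have rank one, since each kills a vector of \<open>principal_frame\<close>; in the form that
  \<open>vderiv_parallel_at_zero\<close> uses.\<close>

lemma dP_parallel:
  assumes u: "u \<in> U"
  shows "(vderiv w P u \<bullet> vderiv w P u) *\<^sub>R vderiv v P u = (vderiv v P u \<bullet> vderiv w P u) *\<^sub>R vderiv w P u"
    and "(vderiv w Q u \<bullet> vderiv w Q u) *\<^sub>R vderiv v Q u = (vderiv v Q u \<bullet> vderiv w Q u) *\<^sub>R vderiv w Q u"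
proof -
  obtain X Y where XY: "frame u X Y" "vderiv X P u = 0" "vderiv Y Q u = 0" using principal_frame[OF u] by blast
  have linP: "linear (\<lambda>v. vderiv v P u)" and linQ: "linear (\<lambda>v. vderiv v Q u)"
    by (rule linear_vderiv, rule smooth_on_differentiable[OF _ u], rule smooth_PQ)+
  have "vderiv v P u = (vderiv v f u \<bullet> vderiv Y f u) *\<^sub>R vderiv Y P u" for v
    using arg_cong[OF ortho_frame_expand[OF linear_df[OF u] XY(1), of v], of "\<lambda>v. vderiv v P u"]
    by (simp only: linear_add[OF linP] linear_scale[OF linP] XY(2) scaleR_zero_right add_0_left add_0_right)
  then obtain s t where "vderiv v P u = s *\<^sub>R vderiv Y P u" "vderiv w P u = t *\<^sub>R vderiv Y P u" by blast
  then show "(vderiv w P u \<bullet> vderiv w P u) *\<^sub>R vderiv v P u = (vderiv v P u \<bullet> vderiv w P u) *\<^sub>R vderiv w P u" by simp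
  have "vderiv v Q u = (vderiv v f u \<bullet> vderiv X f u) *\<^sub>R vderiv X Q u" for v
    using arg_cong[OF ortho_frame_expand[OF linear_df[OF u] XY(1), of v], of "\<lambda>v. vderiv v Q u"]
    by (simp only: linear_add[OF linQ] linear_scale[OF linQ] XY(3) scaleR_zero_right add_0_left add_0_right)
  then obtain s t where "vderiv v Q u = s *\<^sub>R vderiv X Q u" "vderiv w Q u = t *\<^sub>R vderiv X Q u" by blast
  then show "(vderiv w Q u \<bullet> vderiv w Q u) *\<^sub>R vderiv v Q u = (vderiv v Q u \<bullet> vderiv w Q u) *\<^sub>R vderiv w Q u" by simp
qed

text \<open>The number \<open>F \<bullet> G\<close> below is the Gauss curvature at \<open>u\<close>, as \<open>F\<close> and \<open>G\<close> are the normal parts of the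
  second derivatives in two orthonormal principal directions whose mixed normal part vanishes. It is
  computed twice. It is zero because \<open>f\<close> is a sum of functions with orthogonal differentials of rank one;
  the equations for the tension and the bitension field give \<open>2k\<close>.\<close>

lemma no_distinct_principal_curvatures:
  assumes u: "u \<in> U"
  shows False
proof -
  obtain X Y where XY: "frame u X Y" and PX: "vderiv X P u = 0" and QY: "vderiv Y Q u = 0"
    using principal_frame[OF u] by blast
  define x where "x = vderiv X f u"
  define y where "y = vderiv Y f u"
  have xy: "x \<bullet> x = 1" "y \<bullet> y = 1" "x \<bullet> y = 0" "y \<bullet> x = 0"
    using XY by (simp_all add: x_def y_def ortho_frame_def inner_commute)
  note smP = smooth_PQ(1) and smQ = smooth_PQ(2)
  note comm = vderiv_commute[OF U]
  have PQ: "vderiv v P u - vderiv v Q u = (2 * gap) *\<^sub>R vderiv v f u" for v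
    unfolding dP[OF u] dQ[OF u] add_diff_cancel_left scaleR_diff_left[symmetric] by simp
  have PY: "vderiv Y P u = (2 * gap) *\<^sub>R y"
    using PQ[of Y] by (simp add: QY y_def)
  have QX: "vderiv X Q u = - (2 * gap) *\<^sub>R x"
    using PQ[of X] by (simp add: PX x_def minus_equation_iff[of "vderiv X Q u"])
  have par: "w = (w \<bullet> z) *\<^sub>R z" if "(c *\<^sub>R z \<bullet> c *\<^sub>R z) *\<^sub>R w = (w \<bullet> c *\<^sub>R z) *\<^sub>R (c *\<^sub>R z)" "c \<noteq> 0" "z \<bullet> z = 1"
    for w z :: 'e and c
  proof -
    have "(c * c) *\<^sub>R w = (c * c) *\<^sub>R ((w \<bullet> z) *\<^sub>R z)" using that(1,3) by (simp add: mult.assoc mult.left_commute)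
    then show ?thesis using that(2) by (simp only: scaleR_cancel_left) simp
  qed
  \<comment> \<open>As \<open>dP X\<close> vanishes at \<open>u\<close>, the rank one condition makes its derivatives multiples of \<open>dP Y\<close>.\<close>
  have P_X: "vderiv v (vderiv X P) u = (vderiv v (vderiv X P) u \<bullet> y) *\<^sub>R y" for v
    using vderiv_parallel_at_zero[OF U u dP_parallel(1) smooth_on_vderiv[OF smP] smooth_on_vderiv[OF smP] PX, of Y v]
      gap(1) xy(2) unfolding PY by (intro par[of "2 * gap"]) simp_all
  have Q_Y: "vderiv v (vderiv Y Q) u = (vderiv v (vderiv Y Q) u \<bullet> x) *\<^sub>R x" for v
    using vderiv_parallel_at_zero[OF U u dP_parallel(2) smooth_on_vderiv[OF smQ] smooth_on_vderiv[OF smQ] QY, of X v]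
      gap(1) xy(1) unfolding QX by (intro par[of "- (2 * gap)"]) simp_all
  have P_XY: "vderiv X (vderiv Y P) u = vderiv Y (vderiv X P) u" by (rule comm[OF smP u])
  have Q_XY: "vderiv X (vderiv Y Q) u = vderiv Y (vderiv X Q) u" by (rule comm[OF smQ u])
  \<comment> \<open>The mixed derivatives of \<open>P\<close> and \<open>Q\<close> point in the two orthogonal principal directions.\<close>
  have mixed: "vderiv Y (vderiv X P) u \<bullet> vderiv Y (vderiv X Q) u = 0"
    unfolding Q_XY[symmetric] by (subst P_X, subst Q_Y) (simp add: xy)
  have Px: "vderiv v (vderiv X P) u \<bullet> x = 0" for v
    by (subst P_X) (simp add: xy)
  have Qy: "vderiv v (vderiv Y Q) u \<bullet> y = 0" for v
    by (subst Q_Y) (simp add: xy)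
  note orth = vderiv_orth_twice[OF U u dP_perp_dQ smooth_on_vderiv[OF smP] smooth_on_vderiv[OF smQ]]
  have P3: "vderiv X (vderiv Y (vderiv Y P)) u = vderiv Y (vderiv Y (vderiv X P)) u"
  proof -
    have "vderiv X (vderiv Y (vderiv Y P)) u = vderiv Y (vderiv X (vderiv Y P)) u"
      by (rule comm[OF smooth_on_vderiv[OF smP] u])
    also have "\<dots> = vderiv Y (vderiv Y (vderiv X P)) u"
      by (rule vderiv_cong_open[OF U u]) (rule comm[OF smP])
    finally show ?thesis .
  qed
  have Q3: "vderiv X (vderiv Y (vderiv X Q)) u = vderiv X (vderiv X (vderiv Y Q)) u"
    by (rule vderiv_cong_open[OF U u]) (rule comm[OF smQ])
  \<comment> \<open>Three second derivatives of the orthogonality of \<open>dP\<close> and \<open>dQ\<close>; the first two remove the third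
  derivatives from the last one.\<close>
  have E1: "vderiv Y (vderiv Y (vderiv X P)) u \<bullet> vderiv X Q u = 0"
    using orth[of Y Y X X] mixed by (simp add: PX)
  have E2: "vderiv Y P u \<bullet> vderiv X (vderiv X (vderiv Y Q)) u = 0"
    using orth[of X X Y Y] mixed by (simp add: QY P_XY Q_XY)
  have E3: "vderiv Y (vderiv Y P) u \<bullet> vderiv X (vderiv X Q) u = 0"
    using orth[of X Y Y X] mixed by (simp add: E1 E2 P3 Q3 P_XY)
  have first: "vderiv v (vderiv a P) u \<bullet> vderiv b Q u = - (vderiv a P u \<bullet> vderiv v (vderiv b Q) u)" for v a b
    by (rule vderiv_orth[OF U u dP_perp_dQ smooth_on_differentiable[OF smooth_on_vderiv[OF smP] u]
          smooth_on_differentiable[OF smooth_on_vderiv[OF smQ] u]])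
  have Qxy: "vderiv X (vderiv X Q) u \<bullet> y = 0"
    using first[of X Y X] Px[of Y] gap(1) unfolding P_XY QX PY by (simp add: inner_commute)
  have Pyx: "vderiv Y (vderiv Y P) u \<bullet> x = 0"
    using first[of Y Y X] Qy[of X] gap(1) unfolding Q_XY[symmetric] QX PY by (simp add: inner_commute)
  define F where "F = normal_part f u (vderiv X (vderiv X f) u)"
  define G where "G = normal_part f u (vderiv Y (vderiv Y f) u)"
  note lin = linear_normal_part[OF u]
  have Nx: "normal_part f u x = 0" and Ny: "normal_part f u y = 0"
    unfolding normal_part_frame[OF u XY] x_def[symmetric] y_def[symmetric] by (simp_all add: xy)
  have NPX: "normal_part f u (vderiv X (vderiv X P) u) = 0"
    by (subst P_X) (simp add: linear_scale[OF lin] Ny)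
  have NQY: "normal_part f u (vderiv Y (vderiv Y Q) u) = 0"
    by (subst Q_Y) (simp add: linear_scale[OF lin] Nx)
  define HX where "HX = normal_part f u (vderiv X (vderiv X H) u)"
  define HY where "HY = normal_part f u (vderiv Y (vderiv Y H) u)"
  have HXF: "HX + (k + gap) *\<^sub>R F = 0"
    using NPX unfolding ddP[OF u] by (simp add: linear_add[OF lin] linear_scale[OF lin] F_def HX_def)
  have HYG: "HY + (k - gap) *\<^sub>R G = 0"
    using NQY unfolding ddQ[OF u] by (simp add: linear_add[OF lin] linear_scale[OF lin] G_def HY_def)
  have FG: "F + G = 2 *\<^sub>R H u - 2 *\<^sub>R f u"
    using mean_curvature_normal[OF u XY] by (simp add: F_def G_def)
  have HH: "HX + HY = (2 * k) *\<^sub>R f u - 2 *\<^sub>R H u"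
    using biharmonic_normal[OF u XY] unfolding H_norm[OF u] by (simp add: HX_def HY_def)
  \<comment> \<open>\<open>FG\<close> and \<open>HH\<close> are two linear equations for \<open>F\<close> and \<open>G\<close>, as \<open>HX\<close> and \<open>HY\<close> are multiples of them.\<close>
  have gapF: "gap *\<^sub>R F = (1 - k + gap) *\<^sub>R H u - gap *\<^sub>R f u"
  proof -
    have "gap *\<^sub>R F + gap *\<^sub>R F = (HX + (k + gap) *\<^sub>R F) + (HY + (k - gap) *\<^sub>R G) - (HX + HY) - (k - gap) *\<^sub>R (F + G)"
      by (simp add: algebra_simps)
    also have "\<dots> = 2 *\<^sub>R ((1 - k + gap) *\<^sub>R H u - gap *\<^sub>R f u)"
      unfolding HXF HYG HH FG by (simp add: algebra_simps)
    finally have "2 *\<^sub>R (gap *\<^sub>R F) = 2 *\<^sub>R ((1 - k + gap) *\<^sub>R H u - gap *\<^sub>R f u)"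
      by (simp only: scaleR_2)
    then show ?thesis by (simp only: scaleR_cancel_left) simp
  qed
  have gapG: "gap *\<^sub>R G = - (1 - k - gap) *\<^sub>R H u - gap *\<^sub>R f u"
  proof -
    have "gap *\<^sub>R G = gap *\<^sub>R (F + G) - gap *\<^sub>R F" by (simp add: algebra_simps)
    also have "\<dots> = (gap * 2 - (1 - k + gap)) *\<^sub>R H u - (gap * 2 - gap) *\<^sub>R f u"
    proof -
      have "(a *\<^sub>R v - b *\<^sub>R w) - (c *\<^sub>R v - d *\<^sub>R w) = (a - c) *\<^sub>R v - (b - d) *\<^sub>R w"
        for a b c d :: real and v w :: 'e
        by (simp add: scaleR_diff_left)
      then show ?thesis unfolding FG gapF scaleR_diff_right scaleR_scaleR .
    qed
    also have "\<dots> = - (1 - k - gap) *\<^sub>R H u - gap *\<^sub>R f u" by simp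
    finally show ?thesis .
  qed
  \<comment> \<open>The tangential parts of \<open>a\<close> and \<open>b\<close> are orthogonal.\<close>
  have inner_N: "a \<bullet> b = normal_part f u a \<bullet> normal_part f u b" if "a \<bullet> x = 0" "b \<bullet> y = 0" for a b
  proof -
    have "x \<bullet> a = 0" "y \<bullet> b = 0" using that by (simp_all add: inner_commute)
    then show ?thesis
      using that unfolding normal_part_frame[OF u XY] x_def[symmetric] y_def[symmetric]
      by (simp add: inner_diff_left inner_diff_right xy)
  qed
  have NP: "normal_part f u (vderiv Y (vderiv Y P) u) = (2 * gap) *\<^sub>R G"
  proof -
    have "normal_part f u (vderiv Y (vderiv Y P) u) = HY + (k + gap) *\<^sub>R G"
      unfolding ddP[OF u] by (simp only: linear_add[OF lin] linear_scale[OF lin] G_def HY_def)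
    also have "\<dots> = (HY + (k - gap) *\<^sub>R G) + (2 * gap) *\<^sub>R G"
      unfolding add.assoc scaleR_add_left[symmetric] by simp
    finally show ?thesis unfolding HYG by simp
  qed
  have NQ: "normal_part f u (vderiv X (vderiv X Q) u) = - (2 * gap) *\<^sub>R F"
  proof -
    have "normal_part f u (vderiv X (vderiv X Q) u) = HX + (k - gap) *\<^sub>R F"
      unfolding ddQ[OF u] by (simp only: linear_add[OF lin] linear_scale[OF lin] F_def HX_def)
    also have "\<dots> = (HX + (k + gap) *\<^sub>R F) + (- (2 * gap)) *\<^sub>R F"
      unfolding add.assoc scaleR_add_left[symmetric] by simp
    finally show ?thesis unfolding HXF by simp
  qed
  have "((2 * gap) *\<^sub>R G) \<bullet> (- (2 * gap) *\<^sub>R F) = 0"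
    using inner_N[OF Pyx Qxy] E3 unfolding NP NQ by simp
  then have "G \<bullet> F = 0" using gap(1) by simp
  then have "0 = (gap *\<^sub>R G) \<bullet> (gap *\<^sub>R F)" by simp
  also have "\<dots> = gap * gap - (1 - k - gap) * (1 - k + gap) * k"
    unfolding gapF gapG using H_norm[OF u] H_perp_f[OF u] f_unit[OF u]
    by (simp add: inner_diff_left inner_diff_right inner_commute[of "f u" "H u"] algebra_simps)
  also have "(1 - k - gap) * (1 - k + gap) = (1 - k) * (1 - k) - gap * gap" by (simp add: algebra_simps)
  also have "gap * gap - ((1 - k) * (1 - k) - gap * gap) * k = 2 * k * k * (1 - k)"
    unfolding gap(2) by (simp add: algebra_simps)
  finally show False using k by simp
qed

end

end

section \<open>The mean curvature has length 0 or 1\<close>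

text \<open>The hyperplane \<open>q \<bullet> x = 1\<close> has the distance \<open>1 / |q|\<close> from the origin, and \<open>q / 2\<close> is its point
  closest to the origin.\<close>

lemma sphere_section_eq:
  fixes q :: "'e::real_inner"
  assumes "q \<bullet> q = 2"
  shows "sphere 0 1 \<inter> {x. q \<bullet> x = 1} = sphere ((1/2) *\<^sub>R q) (1 / sqrt 2) \<inter> {x. q \<bullet> x = 1}"
proof -
  have "norm x = 1 \<longleftrightarrow> norm (x - (1/2) *\<^sub>R q) = 1 / sqrt 2" if q: "q \<bullet> x = 1" for x
  proof -
    have "x \<bullet> q = 1" using q by (simp add: inner_commute)
    then have "(x - (1/2) *\<^sub>R q) \<bullet> (x - (1/2) *\<^sub>R q) = x \<bullet> x - 1 / 2"
      using q assms by (simp add: inner_diff_left inner_diff_right)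
    then have "norm (x - (1/2) *\<^sub>R q) = 1 / sqrt 2 \<longleftrightarrow> sqrt (x \<bullet> x - 1 / 2) = sqrt (1 / 2)"
      by (simp add: norm_eq_sqrt_inner real_sqrt_divide)
    also have "\<dots> \<longleftrightarrow> x \<bullet> x = 1" by (simp only: real_sqrt_eq_iff) linarith
    finally show ?thesis by (simp add: norm_eq_1)
  qed
  then show ?thesis by (auto simp: dist_norm norm_minus_commute)
qed

context biharmonic_pmc_surface
begin

lemma restrict:
  assumes "open V" "V \<subseteq> U"
  shows "biharmonic_pmc_surface f V"
  by unfold_locales
    (use assms smooth_on_subset[OF smooth] on_sphere immersion pmc biharmonic in auto)

lemma norm_H_constant:
  assumes V: "open V" "connected V" "V \<subseteq> U" and xy: "x \<in> V" "y \<in> V"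
  shows "H x \<bullet> H x = H y \<bullet> H y"
proof (rule vderiv_zero_imp_constant[OF V(1,2) _ _ xy])
  fix z assume "z \<in> V"
  then have z: "z \<in> U" using V by blast
  show "(\<lambda>u. H u \<bullet> H u) differentiable (at z)"
    by (rule smooth_on_differentiable[OF smooth_on_inner[OF U smooth_H smooth_H] z])
  show "vderiv v (\<lambda>u. H u \<bullet> H u) z = 0" for v
    unfolding vderiv_inner[OF diffH[OF z] diffH[OF z]]
    using dH_perp_H[OF z] by (simp add: inner_commute)
qed

text \<open>On a ball, \<open>|H|\<^sup>2\<close> is constant, so a value strictly between 0 and 1 is excluded by
  \<open>no_distinct_principal_curvatures\<close>.\<close>

lemma norm_H_dichotomy:
  assumes u: "u \<in> U" and "H u \<noteq> 0"
  shows "H u \<bullet> H u = 1"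
proof (rule ccontr)
  assume "H u \<bullet> H u \<noteq> 1"
  then have k: "0 < H u \<bullet> H u" "H u \<bullet> H u < 1"
    using norm_H_le_1[OF u] assms(2) by auto
  obtain e where e: "e > 0" "ball u e \<subseteq> U" using U u openE by blast
  interpret B: biharmonic_pmc_surface f "ball u e"
    by (rule restrict[OF open_ball e(2)])
  have uB: "u \<in> ball u e" using e(1) by simp
  show False
    by (rule B.no_distinct_principal_curvatures[OF k norm_H_constant[OF open_ball connected_ball e(2) _ uB] uB])
qed

lemma f_plus_H_constant:
  assumes V: "open V" "connected V" "V \<subseteq> U" and xy: "x \<in> V" "y \<in> V"
    and 1: "\<And>u. u \<in> V \<Longrightarrow> H u \<bullet> H u = 1"
  shows "f x + H x = f y + H y"
proof (rule vderiv_zero_imp_constant[OF V(1,2) _ _ xy])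
  fix z assume zV: "z \<in> V"
  then have z: "z \<in> U" using V by blast
  show "(\<lambda>u. f u + H u) differentiable (at z)"
    by (rule smooth_on_differentiable[OF smooth_on_add[OF U smooth smooth_H] z])
  show "vderiv v (\<lambda>u. f u + H u) z = 0" for v
    unfolding vderiv_add[OF diff[OF z] diffH[OF z]] umbilic_if_norm_1[OF z 1[OF zV]] by simp
qed

text \<open>The vectors \<open>f u\<close> and \<open>H u\<close> are an orthonormal basis of the normal space of the hypersphere at \<open>f u\<close>.
  Projecting to the tangent space of the hypersphere removes from the mean curvature vector its component
  along \<open>H u\<close>, which is all of it.\<close>

lemma minimal_in_hypersphere:
  assumes u: "u \<in> U" and 1: "H u \<bullet> H u = 1"
  shows "mean_curvature (sphere 0 1 \<inter> {x. (f u + H u) \<bullet> x = 1}) f u = 0"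
proof -
  define q where "q = f u + H u"
  define S where "S = sphere 0 1 \<inter> {x. q \<bullet> x = 1}"
  have ff: "f u \<bullet> f u = 1" and Hf: "H u \<bullet> f u = 0" "f u \<bullet> H u = 0"
    using f_unit[OF u] H_perp_f[OF u] by (simp_all add: inner_commute)
  have qq: "q \<bullet> q = 2" by (simp add: q_def inner_add_left inner_add_right ff Hf 1)
  have S_eq: "S = sphere ((1/2) *\<^sub>R q) (1 / sqrt 2) \<inter> {x. q \<bullet> x = 1}"
    unfolding S_def by (rule sphere_section_eq[OF qq])
  have fS: "f u \<in> S"
    using norm_f[OF u] by (simp add: S_def q_def inner_add_left ff Hf)
  have "tangent_space S (f u) = {v. v \<bullet> (f u - (1/2) *\<^sub>R q) = 0 \<and> v \<bullet> q = 0}"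
    unfolding S_eq by (rule tangent_space_round_sphere) (use fS S_eq in \<open>auto simp: qq\<close>)
  also have "\<dots> = {v. v \<bullet> f u = 0 \<and> v \<bullet> H u = 0}"
    by (auto simp: q_def inner_diff_right inner_add_right)
  finally have T: "tan_proj S (f u) w = w - (w \<bullet> f u) *\<^sub>R f u - (w \<bullet> H u) *\<^sub>R H u" for w
    by (rule tan_proj_two_normals) (simp_all add: ff Hf 1)
  obtain X Y where XY: "frame u X Y" using frame_exists[OF u] by blast
  note lin = linear_normal_part[OF u]
  define b where "b v w = II u v w - (vderiv v (vderiv w f) u \<bullet> H u) *\<^sub>R H u" for v w
  have b: "linear (b v)" "linear (\<lambda>v. b v w)" for v w
    unfolding b_def[abs_def] using linear_II[OF u] linear_vderiv_vderiv[OF U smooth u]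
    by (auto simp: linear_iff inner_add_left scaleR_add_left scaleR_diff_right)
  have sff: "second_fundamental_form S f i j u = b (axis i 1) (axis j 1)" for i j
    unfolding second_fundamental_form_def cov_deriv_def T partial_deriv_eq_vderiv b_def II_def ddf_inner_f[OF u]
    by (simp add: linear_add[OF lin] linear_diff[OF lin] linear_scale[OF lin] normal_part_f[OF u] normal_part_H[OF u])
  have "vderiv X (vderiv X f) u \<bullet> H u + vderiv Y (vderiv Y f) u \<bullet> H u = 2"
    using trace_dH[OF u XY] unfolding 1 dH_inner_df[OF u] by (simp add: inner_commute)
  moreover have "II u X X + II u Y Y = 2 *\<^sub>R H u"
    unfolding mean_curvature_frame[OF u XY] by simp
  moreover have "b X X + b Y Y = (II u X X + II u Y Y)
      - (vderiv X (vderiv X f) u \<bullet> H u + vderiv Y (vderiv Y f) u \<bullet> H u) *\<^sub>R H u"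
    by (simp add: b_def scaleR_add_left)
  ultimately have "b X X + b Y Y = 0" by simp
  then show ?thesis
    unfolding q_def[symmetric] S_def[symmetric] mean_curvature_def[of S] sff metric_trace_eq[OF u XY b] by simp
qed

end

section \<open>Change of charts and conclusion\<close>

text \<open>By the chain rule, the second derivatives of \<open>f\<close> are those of \<open>f'\<close> in the transformed directions,
  plus a term with the second derivative of the coordinate change \<open>\<psi>\<close>, which is tangent to the surface
  and has no normal part. The derivative of \<open>\<psi>\<close> maps frames to frames.\<close>

lemma mean_curvature_change_of_chart:
  fixes f f' :: "real ^ 2 \<Rightarrow> 'e::euclidean_space"
  assumes S: "spherical_surface f U" and S': "spherical_surface f' U'"
    and W: "open W" "W \<subseteq> U" and \<psi>: "smooth_on \<psi> W" "\<psi> ` W \<subseteq> U'"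
    and eq: "\<And>w. w \<in> W \<Longrightarrow> f w = f' (\<psi> w)" and u: "u \<in> W"
  shows "mean_curvature (sphere 0 1) f u = mean_curvature (sphere 0 1) f' (\<psi> u)"
proof -
  interpret F: spherical_surface f U by (rule S)
  interpret G: spherical_surface f' U' by (rule S')
  have mem: "w \<in> U" "\<psi> w \<in> U'" if "w \<in> W" for w using that W \<psi> by auto
  note d\<psi> = smooth_on_differentiable[OF \<psi>(1)]
  let ?e1 = "axis 1 1 :: real ^ 2" and ?e2 = "axis 2 1 :: real ^ 2"
  have df: "vderiv v f w = vderiv (vderiv v \<psi> w) f' (\<psi> w)" if w: "w \<in> W" for v w
    using vderiv_cong_open[OF W(1) w eq] vderiv_compose[OF G.diff[OF mem(2)[OF w]] d\<psi>[OF w]] by simp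
  have coord: "L z = (z \<bullet> ?e1) *\<^sub>R L ?e1 + (z \<bullet> ?e2) *\<^sub>R L ?e2" if L: "linear L" for L :: "real ^ 2 \<Rightarrow> 'e" and z
    using arg_cong[OF vec2_expand[of z], of L] by (simp only: linear_add[OF L] linear_scale[OF L] inner_axis inner_real_def mult_1_right)
  have df2: "vderiv v f w = (vderiv v \<psi> w \<bullet> ?e1) *\<^sub>R vderiv ?e1 f' (\<psi> w) + (vderiv v \<psi> w \<bullet> ?e2) *\<^sub>R vderiv ?e2 f' (\<psi> w)"
    if w: "w \<in> W" for v w
    unfolding df[OF w] by (rule coord[OF G.linear_df[OF mem(2)[OF w]]])
  have summand: "vderiv x (\<lambda>w. (vderiv v \<psi> w \<bullet> e) *\<^sub>R vderiv e f' (\<psi> w)) u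
      = (vderiv v \<psi> u \<bullet> e) *\<^sub>R vderiv (vderiv x \<psi> u) (vderiv e f') (\<psi> u)
        + (vderiv x (vderiv v \<psi>) u \<bullet> e) *\<^sub>R vderiv e f' (\<psi> u)"
    and summand_diff: "(\<lambda>w. (vderiv v \<psi> w \<bullet> e) *\<^sub>R vderiv e f' (\<psi> w)) differentiable (at u)" for x v e
  proof -
    have 1: "(\<lambda>w. vderiv v \<psi> w \<bullet> e) differentiable (at u)"
      by (rule smooth_on_differentiable[OF smooth_on_inner[OF W(1) smooth_on_vderiv[OF \<psi>(1)] smooth_on_const] u])
    have 2: "(\<lambda>w. vderiv e f' (\<psi> w)) differentiable (at u)"
      using differentiable_chain_at[OF d\<psi>[OF u] G.diff1[OF mem(2)[OF u]]] by (simp add: o_def)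
    show "vderiv x (\<lambda>w. (vderiv v \<psi> w \<bullet> e) *\<^sub>R vderiv e f' (\<psi> w)) u
      = (vderiv v \<psi> u \<bullet> e) *\<^sub>R vderiv (vderiv x \<psi> u) (vderiv e f') (\<psi> u)
        + (vderiv x (vderiv v \<psi>) u \<bullet> e) *\<^sub>R vderiv e f' (\<psi> u)"
      unfolding vderiv_bilinear[OF bounded_bilinear_scaleR 1 2]
        vderiv_compose[OF G.diff1[OF mem(2)[OF u]] d\<psi>[OF u]]
        vderiv_inner_const[OF smooth_on_differentiable[OF smooth_on_vderiv[OF \<psi>(1)] u]] ..
    show "(\<lambda>w. (vderiv v \<psi> w \<bullet> e) *\<^sub>R vderiv e f' (\<psi> w)) differentiable (at u)"
      using bounded_bilinear.FDERIV[OF bounded_bilinear_scaleR has_derivative_vderiv[OF 1] has_derivative_vderiv[OF 2]]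
      unfolding differentiable_def by blast
  qed
  have ddf: "vderiv x (vderiv v f) u = vderiv (vderiv x \<psi> u) (vderiv (vderiv v \<psi> u) f') (\<psi> u)
      + vderiv (vderiv x (vderiv v \<psi>) u) f' (\<psi> u)" for x v
  proof -
    have "vderiv x (vderiv v f) u = vderiv x (\<lambda>w. (vderiv v \<psi> w \<bullet> ?e1) *\<^sub>R vderiv ?e1 f' (\<psi> w)
        + (vderiv v \<psi> w \<bullet> ?e2) *\<^sub>R vderiv ?e2 f' (\<psi> w)) u"
      by (rule vderiv_cong_open[OF W(1) u df2])
    also have "\<dots> = ((vderiv v \<psi> u \<bullet> ?e1) *\<^sub>R vderiv (vderiv x \<psi> u) (vderiv ?e1 f') (\<psi> u)
          + (vderiv v \<psi> u \<bullet> ?e2) *\<^sub>R vderiv (vderiv x \<psi> u) (vderiv ?e2 f') (\<psi> u))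
        + ((vderiv x (vderiv v \<psi>) u \<bullet> ?e1) *\<^sub>R vderiv ?e1 f' (\<psi> u)
          + (vderiv x (vderiv v \<psi>) u \<bullet> ?e2) *\<^sub>R vderiv ?e2 f' (\<psi> u))"
      unfolding vderiv_add[OF summand_diff summand_diff] summand by (simp only: add_ac)
    also have "\<dots> = vderiv (vderiv x \<psi> u) (vderiv (vderiv v \<psi> u) f') (\<psi> u)
      + vderiv (vderiv x (vderiv v \<psi>) u) f' (\<psi> u)"
      using coord[OF linear_vderiv_vderiv(2)[OF G.U G.smooth mem(2)[OF u]], of "vderiv x \<psi> u" "vderiv v \<psi> u"]
        coord[OF G.linear_df[OF mem(2)[OF u]], of "vderiv x (vderiv v \<psi>) u"] by simp
    finally show ?thesis .
  qed
  obtain X Y where XY: "F.frame u X Y" using F.frame_exists[OF mem(1)[OF u]] by blast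
  define X' where "X' = vderiv X \<psi> u"
  define Y' where "Y' = vderiv Y \<psi> u"
  have XY': "G.frame (\<psi> u) X' Y'"
    using XY unfolding ortho_frame_def X'_def Y'_def df[OF u] .
  have N: "normal_part f u w = normal_part f' (\<psi> u) w" for w
    unfolding F.normal_part_frame[OF mem(1)[OF u] XY] G.normal_part_frame[OF mem(2)[OF u] XY']
    by (simp only: X'_def Y'_def df[OF u])
  have N0: "normal_part f' (\<psi> u) (vderiv z f' (\<psi> u)) = 0" for z
    by (rule G.normal_part_df[OF mem(2)[OF u]])
  have "F.II u v v = G.II (\<psi> u) (vderiv v \<psi> u) (vderiv v \<psi> u)" for v
    unfolding F.II_def G.II_def N ddf df[OF u] eq[OF u]
    by (simp add: linear_add[OF G.linear_normal_part[OF mem(2)[OF u]]] N0)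
  then show ?thesis
    unfolding F.mean_curvature_frame[OF mem(1)[OF u] XY] G.mean_curvature_frame[OF mem(2)[OF u] XY']
    by (simp only: X'_def Y'_def)
qed

lemma locally_constant_imp_constant:
  assumes X: "connected_space X"
    and loc: "\<And>x. x \<in> topspace X \<Longrightarrow> \<exists>T. openin X T \<and> x \<in> T \<and> (\<forall>y\<in>T. F y = F x)"
    and xy: "x \<in> topspace X" "y \<in> topspace X"
  shows "F x = F y"
proof (rule ccontr)
  assume ne: "F x \<noteq> F y"
  have op: "openin X {z \<in> topspace X. P (F z)}" for P
  proof (subst openin_subopen, intro ballI)
    fix z assume z: "z \<in> {z \<in> topspace X. P (F z)}"
    then obtain O' where "openin X O'" "z \<in> O'" "\<forall>y\<in>O'. F y = F z" using loc by blast
    then show "\<exists>T. openin X T \<and> z \<in> T \<and> T \<subseteq> {z \<in> topspace X. P (F z)}"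
      using z openin_subset by (intro exI[of _ O']) fastforce
  qed
  have "\<not> connected_space X"
    unfolding connected_space_def not_not
    by (intro exI[of _ "{z \<in> topspace X. F z = F x}"] exI[of _ "{z \<in> topspace X. F z \<noteq> F x}"])
      (use op[of "\<lambda>c. c = F x"] op[of "\<lambda>c. c \<noteq> F x"] xy ne in auto)
  then show False using X by blast
qed

theorem theorem5p6:
  fixes X :: "'p topology"
    and \<A> :: "('p, 2) chart set"
    and \<phi> :: "'p \<Rightarrow> 'e::euclidean_space"
    and n :: nat
  assumes "DIM('e) = n + 1"
    and "submanifold X \<A> \<phi> (sphere 0 1)"
    and "proper_biharmonic_submanifold \<A> \<phi> (sphere 0 1)"
    and "parallel_mean_curvature \<A> \<phi> (sphere 0 1)"
  shows "\<exists>S. hypersphere (1 / sqrt 2) S \<and> minimal_submanifold X \<A> \<phi> S"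
proof -
  note sub = assms(2)[unfolded submanifold_def]
  have mfd: "smooth_manifold X \<A>" using sub by blast
  have conn: "connected_space X" and cover: "(\<Union>(D, c)\<in>\<A>. D) = topspace X"
    using mfd by (simp_all add: smooth_manifold_def)
  have chart_at: "\<exists>D c. (D, c) \<in> \<A> \<and> x \<in> D" if "x \<in> topspace X" for x
    using that unfolding cover[symmetric] by auto
  have chart: "openin X D" "open (c ` D)" "homeomorphic_map (subtopology X D) (subtopology euclidean (c ` D)) c"
    if "(D, c) \<in> \<A>" for D c
    using mfd that unfolding smooth_manifold_def by blast+
  have transition: "smooth_on (c' \<circ> inv_into D c) (c ` (D \<inter> D'))" if "(D, c) \<in> \<A>" "(D', c') \<in> \<A>" for D c D' c'
    using mfd that unfolding smooth_manifold_def by blast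
  have top: "topspace (subtopology X D) = D" if "(D, c) \<in> \<A>" for D c
    using openin_subset[OF chart(1)[OF that]] by (auto simp: topspace_subtopology)
  have inj: "inj_on c D" if "(D, c) \<in> \<A>" for D c
    using homeomorphic_imp_injective_map[OF chart(3)[OF that]] top[OF that] by simp
  have inv: "inv_into D c (c x) = x" if "(D, c) \<in> \<A>" "x \<in> D" for D c x
    using inv_into_f_f[OF inj[OF that(1)] that(2)] .
  have surf: "biharmonic_pmc_surface (\<phi> \<circ> inv_into D c) (c ` D)" if A: "(D, c) \<in> \<A>" for D c
  proof unfold_locales
    show "open (c ` D)" by (rule chart(2)[OF A])
    show "smooth_on (\<phi> \<circ> inv_into D c) (c ` D)" using sub A by blast
    fix u assume u: "u \<in> c ` D"
    then obtain x where x: "x \<in> D" "u = c x" by blast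
    then have "\<phi> x \<in> sphere 0 1"
      using sub openin_subset[OF chart(1)[OF A]] by blast
    then show "(\<phi> \<circ> inv_into D c) u \<in> sphere 0 1"
      using inv[OF A] x by simp
    show "inj (frechet_derivative (\<phi> \<circ> inv_into D c) (at u))" using sub A u by blast
    show "normal_conn (sphere 0 1) (\<phi> \<circ> inv_into D c) i (mean_curvature (sphere 0 1) (\<phi> \<circ> inv_into D c)) u = 0" for i
      using assms(4) A u unfolding parallel_mean_curvature_def Let_def by blast
    show "bitension (sphere 0 1) (induced_metric (\<phi> \<circ> inv_into D c)) (\<phi> \<circ> inv_into D c) u = 0"
      using assms(3) A u unfolding proper_biharmonic_submanifold_def biharmonic_submanifold_def Let_def by blast
  qed
  have open_overlap: "open (c ` (D \<inter> D'))" if A: "(D, c) \<in> \<A>" "(D', c') \<in> \<A>" for D c D' c'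
  proof -
    have "openin (subtopology X D) (D \<inter> D')"
      using openin_subtopology_Int2[OF chart(1)[OF A(2)], of D] by simp
    then have "openin (subtopology euclidean (c ` D)) (c ` (D \<inter> D'))"
      using homeomorphic_imp_open_map[OF chart(3)[OF A(1)]] unfolding open_map_def by blast
    then show ?thesis using chart(2)[OF A(1)] openin_open_trans by blast
  qed
  have change: "mean_curvature (sphere 0 1) (\<phi> \<circ> inv_into D c) (c x)
      = mean_curvature (sphere 0 1) (\<phi> \<circ> inv_into D' c') (c' x)"
    if A: "(D, c) \<in> \<A>" "(D', c') \<in> \<A>" and x: "x \<in> D" "x \<in> D'" for D c D' c' x
  proof -
    have "mean_curvature (sphere 0 1) (\<phi> \<circ> inv_into D c) (c x)
      = mean_curvature (sphere 0 1) (\<phi> \<circ> inv_into D' c') ((c' \<circ> inv_into D c) (c x))"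
    proof (rule mean_curvature_change_of_chart)
      show "spherical_surface (\<phi> \<circ> inv_into D c) (c ` D)" "spherical_surface (\<phi> \<circ> inv_into D' c') (c' ` D')"
        using surf[OF A(1)] surf[OF A(2)] by (simp_all add: biharmonic_pmc_surface_def)
      show "open (c ` (D \<inter> D'))" by (rule open_overlap[OF A])
      show "c ` (D \<inter> D') \<subseteq> c ` D" "c x \<in> c ` (D \<inter> D')" using x by auto
      show "smooth_on (c' \<circ> inv_into D c) (c ` (D \<inter> D'))" by (rule transition[OF A])
      show "(c' \<circ> inv_into D c) ` c ` (D \<inter> D') \<subseteq> c' ` D'" using inv[OF A(1)] by auto
      show "(\<phi> \<circ> inv_into D c) w = (\<phi> \<circ> inv_into D' c') ((c' \<circ> inv_into D c) w)" if "w \<in> c ` (D \<inter> D')" for w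
        using that inv[OF A(1)] inv[OF A(2)] by auto
    qed
    then show ?thesis using inv[OF A(1) x(1)] by simp
  qed
  \<comment> \<open>The mean curvature vector as a function on the manifold, with an arbitrary chart at each point;
  by \<open>change\<close> all charts give the same value.\<close>
  define h where "h x = (let (D, c) = (SOME (D, c). (D, c) \<in> \<A> \<and> x \<in> D)
    in mean_curvature (sphere 0 1) (\<phi> \<circ> inv_into D c) (c x))" for x
  have h: "h x = mean_curvature (sphere 0 1) (\<phi> \<circ> inv_into D c) (c x)" if A: "(D, c) \<in> \<A>" "x \<in> D" for D c x
  proof -
    obtain D' c' where s: "(SOME (D, c). (D, c) \<in> \<A> \<and> x \<in> D) = (D', c')" by fastforce
    have "case (D', c') of (D, c) \<Rightarrow> (D, c) \<in> \<A> \<and> x \<in> D"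
      unfolding s[symmetric] by (rule someI[of _ "(D, c)"]) (use A in simp)
    then have "(D', c') \<in> \<A>" "x \<in> D'" by auto
    from change[OF this(1) A(1) this(2) A(2)] show ?thesis by (simp add: h_def s)
  qed
  have f: "(\<phi> \<circ> inv_into D c) (c x) = \<phi> x" if "(D, c) \<in> \<A>" "x \<in> D" for D c x
    using inv[OF that] by simp
  have nbhd: "\<exists>D c T B. (D, c) \<in> \<A> \<and> openin X T \<and> x \<in> T \<and> T \<subseteq> D \<and> open B \<and> connected B \<and> B \<subseteq> c ` D \<and> c ` T \<subseteq> B"
    if x: "x \<in> topspace X" for x
  proof -
    obtain D c where A: "(D, c) \<in> \<A>" and xD: "x \<in> D" using chart_at[OF x] by blast
    obtain e where e: "e > 0" "ball (c x) e \<subseteq> c ` D"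
      using openE[OF chart(2)[OF A], of "c x"] xD by blast
    define T where "T = {y \<in> topspace (subtopology X D). c y \<in> ball (c x) e}"
    have "openin (subtopology X D) T"
      unfolding T_def
    proof (rule openin_continuous_map_preimage[OF homeomorphic_imp_continuous_map[OF chart(3)[OF A]]])
      show "openin (subtopology euclidean (c ` D)) (ball (c x) e)"
        using e(2) by (simp add: openin_open_eq[OF chart(2)[OF A]])
    qed
    then have "openin X T" by (rule openin_trans_full[OF _ chart(1)[OF A]])
    moreover have "x \<in> T" "T \<subseteq> D" "c ` T \<subseteq> ball (c x) e"
      using xD e(1) unfolding T_def top[OF A] by auto
    ultimately show ?thesis using A e(2) by (meson open_ball connected_ball)
  qed
  have norm_const: "h x \<bullet> h x = h y \<bullet> h y" if "x \<in> topspace X" "y \<in> topspace X" for x y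
  proof (rule locally_constant_imp_constant[OF conn _ that, of "\<lambda>x. h x \<bullet> h x"])
    fix x assume "x \<in> topspace X"
    then obtain D c T B where A: "(D, c) \<in> \<A>" and T: "openin X T" "x \<in> T" "T \<subseteq> D"
      and B: "open B" "connected B" "B \<subseteq> c ` D" "c ` T \<subseteq> B" using nbhd by blast
    have "h y \<bullet> h y = h x \<bullet> h x" if "y \<in> T" for y
    proof -
      have D: "y \<in> D" "x \<in> D" and "c y \<in> B" "c x \<in> B" using that T B(4) by auto
      then show ?thesis
        unfolding h[OF A D(1)] h[OF A D(2)]
        by (intro biharmonic_pmc_surface.norm_H_constant[OF surf[OF A] B(1-3)])
    qed
    then show "\<exists>T. openin X T \<and> x \<in> T \<and> (\<forall>y\<in>T. h y \<bullet> h y = h x \<bullet> h x)" using T by blast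
  qed
  \<comment> \<open>A surface that is not harmonic has a point where the tension field, and so \<open>H\<close>, does not vanish.\<close>
  obtain x0 where x0: "x0 \<in> topspace X" "h x0 \<noteq> 0"
  proof -
    obtain D c u where A: "(D, c) \<in> \<A>" and u: "u \<in> c ` D"
      and "tension (sphere 0 1) (induced_metric (\<phi> \<circ> inv_into D c)) (\<phi> \<circ> inv_into D c) u \<noteq> 0"
      using assms(3) unfolding proper_biharmonic_submanifold_def harmonic_submanifold_def Let_def by blast
    moreover have "spherical_surface (\<phi> \<circ> inv_into D c) (c ` D)"
      using surf[OF A] by (simp add: biharmonic_pmc_surface_def)
    ultimately have "mean_curvature (sphere 0 1) (\<phi> \<circ> inv_into D c) u \<noteq> 0"
      using spherical_surface.tension_eq by force
    then show ?thesis using that u h[OF A] openin_subset[OF chart(1)[OF A]] by auto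
  qed
  have h1: "h x \<bullet> h x = 1" if "x \<in> topspace X" for x
  proof -
    obtain D c where A: "(D, c) \<in> \<A>" and xD: "x0 \<in> D" using chart_at[OF x0(1)] by blast
    have "h x0 \<bullet> h x0 = 1"
      using biharmonic_pmc_surface.norm_H_dichotomy[OF surf[OF A], of "c x0"] h[OF A xD] x0(2) xD by simp
    then show ?thesis using norm_const[OF that x0(1)] by simp
  qed
  have sum_const: "\<phi> x + h x = \<phi> y + h y" if "x \<in> topspace X" "y \<in> topspace X" for x y
  proof (rule locally_constant_imp_constant[OF conn _ that, of "\<lambda>x. \<phi> x + h x"])
    fix x assume "x \<in> topspace X"
    then obtain D c T B where A: "(D, c) \<in> \<A>" and T: "openin X T" "x \<in> T" "T \<subseteq> D"
      and B: "open B" "connected B" "B \<subseteq> c ` D" "c ` T \<subseteq> B" using nbhd by blast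
    have 1: "mean_curvature (sphere 0 1) (\<phi> \<circ> inv_into D c) u \<bullet> mean_curvature (sphere 0 1) (\<phi> \<circ> inv_into D c) u = 1"
      if u: "u \<in> B" for u
    proof -
      obtain z where "z \<in> D" "u = c z" using u B(3) by blast
      then show ?thesis using h1[of z] h[OF A] openin_subset[OF chart(1)[OF A]] by auto
    qed
    have "\<phi> y + h y = \<phi> x + h x" if "y \<in> T" for y
    proof -
      have D: "y \<in> D" "x \<in> D" and "c y \<in> B" "c x \<in> B" using that T B(4) by auto
      then show ?thesis
        unfolding h[OF A D(1)] h[OF A D(2)] f[OF A D(1), symmetric] f[OF A D(2), symmetric]
        by (intro biharmonic_pmc_surface.f_plus_H_constant[OF surf[OF A] B(1-3) _ _ 1])
    qed
    then show "\<exists>T. openin X T \<and> x \<in> T \<and> (\<forall>y\<in>T. \<phi> y + h y = \<phi> x + h x)" using T by blast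
  qed
  define q where "q = \<phi> x0 + h x0"
  define S where "S = sphere 0 1 \<inter> {x. q \<bullet> x = 1}"
  have point: "\<phi> x \<bullet> \<phi> x = 1" "h x \<bullet> \<phi> x = 0" "q = \<phi> x + h x" if x: "x \<in> topspace X" for x
  proof -
    obtain D c where A: "(D, c) \<in> \<A>" and xD: "x \<in> D" using chart_at[OF x] by blast
    interpret biharmonic_pmc_surface "\<phi> \<circ> inv_into D c" "c ` D" by (rule surf[OF A])
    show "\<phi> x \<bullet> \<phi> x = 1" "h x \<bullet> \<phi> x = 0"
      using f_unit[of "c x"] H_perp_f[of "c x"] xD unfolding f[OF A xD] h[OF A xD] by auto
    show "q = \<phi> x + h x" unfolding q_def by (rule sum_const[OF x0(1) x])
  qed
  have qq: "q \<bullet> q = 2"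
    using point[OF x0(1)] h1[OF x0(1)] by (simp add: inner_add_left inner_add_right inner_commute[of "\<phi> x0" "h x0"])
  have "hypersphere (1 / sqrt 2) S"
    unfolding hypersphere_def
  proof (intro conjI exI)
    show "q \<noteq> 0" using qq by auto
    show "q \<bullet> ((1/2) *\<^sub>R q) = 1" using qq by simp
    show "S = sphere 0 1 \<inter> {x. q \<bullet> x = 1}" by (rule S_def)
    show "S = sphere ((1/2) *\<^sub>R q) (1 / sqrt 2) \<inter> {x. q \<bullet> x = 1}"
      unfolding S_def by (rule sphere_section_eq[OF qq])
  qed simp
  moreover have "minimal_submanifold X \<A> \<phi> S"
    unfolding minimal_submanifold_def submanifold_def
  proof (intro conjI)
    show "smooth_manifold X \<A>" by (rule mfd)
    show "\<phi> ` topspace X \<subseteq> S"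
      using point by (auto simp: S_def norm_eq_1 inner_add_left)
    show "\<forall>(D, c)\<in>\<A>. smooth_on (\<phi> \<circ> inv_into D c) (c ` D) \<and>
        (\<forall>u\<in>c ` D. inj (frechet_derivative (\<phi> \<circ> inv_into D c) (at u)))"
      using sub by blast
    have "mean_curvature S (\<phi> \<circ> inv_into D c) u = 0" if A: "(D, c) \<in> \<A>" and u: "u \<in> c ` D" for D c u
    proof -
      obtain x where xD: "x \<in> D" and ux: "u = c x" using u by blast
      have x: "x \<in> topspace X" using xD openin_subset[OF chart(1)[OF A]] by blast
      show ?thesis
        using biharmonic_pmc_surface.minimal_in_hypersphere[OF surf[OF A] u] h1[OF x]
        unfolding ux h[OF A xD, symmetric] f[OF A xD] point(3)[OF x, symmetric] S_def[symmetric] .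
    qed
    then show "\<forall>(D, c)\<in>\<A>. \<forall>u\<in>c ` D. mean_curvature S (\<phi> \<circ> inv_into D c) u = 0" by blast
  qed
  ultimately show ?thesis by blast
qed

end
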